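(* Let $\mathbb{D}$ be a division ring with finite dimension $d$ over a central subfield $\mathbb{F}$, and assume that $\mathbb{D}$ has quadratic type over $\mathbb{F}$, with associated pair $(\sigma,e)$. Let $U$ and $V$ be finite-dimensional right $\mathbb{D}$-vector spaces with $n:=\dim_{\mathbb{D}}V>0$, and let $B:U\times V\to\mathbb{D}$ be a right-nondegenerate $\sigma$-sesquilinear form. Set $b:(x,y)\in U\times V\mapsto e(B(x,y))$. Then $\mathcal{A}_{b,\mathbb{D}}$ has dimension $\alpha(n,d):=n(d-1)+d\binom{n}{2}$ over $\mathbb{F}$, and it is deeply intransitive.
   Context: A central subfield of $\mathbb{D}$ is a subfield contained in the center of $\mathbb{D}$. $\mathcal{A}_{b,\mathbb{D}}$ is the set of all $f\in\operatorname{Hom}_{\mathbb{D}}(U,V)$ such that $b(x,f(x))=0$ for all $x\in U$. For an $\mathbb{F}$-linear subspace $S$ of $\operatorname{Hom}_{\mathbb{D}}(U,V)$ and $x\in U$, write $Sx:=\{f(x):f\in S\}$. $S$ is intransitive if $Sx\neq V$ for all $x\in U$. For a $\mathbb{D}$-linear subspace $V'$ of $V$, $S^{V'}$ is the set of all $f\in S$ whose range is contained in $V'$. $S$ is deeply intransitive if it is intransitive and, for every nonzero $\mathbb{D}$-linear subspace $V'$ of $V$, $S^{V'}$ is intransitive as an $\mathbb{F}$-linear subspace of $\operatorname{Hom}_{\mathbb{D}}(U,V')$. $\mathbb{D}$ is of quadratic type over $\mathbb{F}$ if one of the following holds: (i) $d=1$; (ii) $d=2$ and $\mathbb{D}$ is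 a separable field extension of $\mathbb{F}$; (iii) $d=4$ and $\mathbb{D}$ is a quaternion algebra over $\mathbb{F}$; (iv) $d=2^m$ for some $m\geq 1$, $\operatorname{char}(\mathbb{F})=2$, $\mathbb{D}$ is a field and $x^2\in\mathbb{F}$ for all $x\in\mathbb{D}$. The standard involution $\sigma$ of $\mathbb{D}$ is the identity of $\mathbb{D}$ in cases (i) and (iv), the non-identity $\mathbb{F}$-automorphism in case (ii), and the quaternionic conjugation in case (iii). An associated pair $(\sigma,e)$ for $\mathbb{D}$ over $\mathbb{F}$ consists of the standard involution $\sigma$ and of an $\mathbb{F}$-linear form $e:\mathbb{D}\to\mathbb{F}$ which is the Galois trace of $\mathbb{D}$ over $\mathbb{F}$ in cases (i) and (ii) (so $e=\operatorname{id}$ if $d=1$), the reduced trace $x\mapsto x+\sigma(x)$ in case (iii), and an arbitrary nonzero $\mathbb{F}$-linear form on $\mathbb{D}$ in case (iv). A $\sigma$-sesquilinear form on $U\times V$ is a map $B:U\times V\to\mathbb{D}$ such that $B(x\alpha+x',y)=\sigma(\alpha)B(x,y)+B(x',y)$ and $B(x,y\alpha+y')=B(x,y)\alpha+B(x,y')$ for all $\alpha\in\mathbb{D}$, $x,x'\in U$, $y,y'\in V$. It is right-nondegenerate if $\{y\in V: B(x,y)=0\text{ for all }x\in U\}=\{0\}$. *)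

theory Defs
  imports
    "HOL-Library.Function_Algebras"
    "HOL-Computational_Algebra.Computational_Algebra"
begin

text \<open>The library's \<^const>\<open>vector_space.dim\<close> is a total function, so finiteness of the dimension
  has to be stated separately.\<close>

definition has_dimension :: "('f::field \<Rightarrow> 'b::ab_group_add \<Rightarrow> 'b) \<Rightarrow> 'b set \<Rightarrow> nat \<Rightarrow> bool" where
  "has_dimension s W k \<longleftrightarrow>
     module.subspace s W \<and> (\<exists>X. finite X \<and> module.span s X = W) \<and> vector_space.dim s W = k"

text \<open>The division ring is a type \<open>'d\<close>. The central subfield is given as a field type \<open>'f\<close> together
  with a ring homomorphism \<open>\<iota>\<close> into the center of \<open>'d\<close>. Such a homomorphism is injective, and
  \<open>'f\<close> is identified with its image.\<close>

locale central_subfield =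
  fixes \<iota> :: "'f::field \<Rightarrow> 'd::division_ring"
  assumes emb_add: "\<iota> (a + b) = \<iota> a + \<iota> b"
    and emb_mult: "\<iota> (a * b) = \<iota> a * \<iota> b"
    and emb_one: "\<iota> 1 = 1"
    and emb_central: "\<iota> a * x = x * \<iota> a"

definition scaleD :: "('f::field \<Rightarrow> 'd::division_ring) \<Rightarrow> 'f \<Rightarrow> 'd \<Rightarrow> 'd" where
  "scaleD \<iota> c x = \<iota> c * x"

lemma (in central_subfield) vector_space_scaleD: "vector_space (scaleD \<iota>)"
  by unfold_locales (simp_all add: scaleD_def emb_add emb_mult emb_one algebra_simps)

text \<open>The library locale \<^locale>\<open>vector_space\<close> requires a commutative field of scalars.\<close>

locale right_vector_space =
  fixes scale :: "'v::ab_group_add \<Rightarrow> 'd::division_ring \<Rightarrow> 'v"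
  assumes scale_add_left: "scale (x + y) a = scale x a + scale y a"
    and scale_add_right: "scale x (a + b) = scale x a + scale x b"
    and scale_scale: "scale (scale x a) b = scale x (a * b)"
    and scale_one: "scale x 1 = x"

definition rsubspace :: "('v::ab_group_add \<Rightarrow> 'd::division_ring \<Rightarrow> 'v) \<Rightarrow> 'v set \<Rightarrow> bool" where
  "rsubspace s W \<longleftrightarrow> 0 \<in> W \<and> (\<forall>x\<in>W. \<forall>y\<in>W. x + y \<in> W) \<and> (\<forall>x\<in>W. \<forall>a. s x a \<in> W)"

definition rspan :: "('v::ab_group_add \<Rightarrow> 'd::division_ring \<Rightarrow> 'v) \<Rightarrow> 'v set \<Rightarrow> 'v set" where
  "rspan s X = rsubspace s hull X"

definition rindependent :: "('v::ab_group_add \<Rightarrow> 'd::division_ring \<Rightarrow> 'v) \<Rightarrow> 'v set \<Rightarrow> bool" where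
  "rindependent s X \<longleftrightarrow> (\<forall>x\<in>X. x \<notin> rspan s (X - {x}))"

definition rfinite_dim :: "('v::ab_group_add \<Rightarrow> 'd::division_ring \<Rightarrow> 'v) \<Rightarrow> bool" where
  "rfinite_dim s \<longleftrightarrow> (\<exists>X. finite X \<and> rspan s X = UNIV)"

definition rdim :: "('v::ab_group_add \<Rightarrow> 'd::division_ring \<Rightarrow> 'v) \<Rightarrow> nat" where
  "rdim s = card (SOME X. rindependent s X \<and> rspan s X = UNIV)"

definition rlinear ::
  "('u::ab_group_add \<Rightarrow> 'd::division_ring \<Rightarrow> 'u) \<Rightarrow> ('v::ab_group_add \<Rightarrow> 'd \<Rightarrow> 'v) \<Rightarrow> ('u \<Rightarrow> 'v) \<Rightarrow> bool"
  where
  "rlinear sU sV f \<longleftrightarrow> (\<forall>x y. f (x + y) = f x + f y) \<and> (\<forall>x a. f (sU x a) = sV (f x) a)"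

definition scaleHom ::
  "('f::field \<Rightarrow> 'd::division_ring) \<Rightarrow> ('v::ab_group_add \<Rightarrow> 'd \<Rightarrow> 'v) \<Rightarrow> 'f \<Rightarrow> ('u \<Rightarrow> 'v) \<Rightarrow> ('u \<Rightarrow> 'v)"
  where
  "scaleHom \<iota> sV c f = (\<lambda>x. sV (f x) (\<iota> c))"

lemma vector_space_scaleHom:
  assumes "central_subfield \<iota>" and "right_vector_space sV"
  shows "vector_space (scaleHom \<iota> sV)"
proof -
  interpret central_subfield \<iota> by fact
  interpret right_vector_space sV by fact
  have comm: "\<iota> b * \<iota> a = \<iota> a * \<iota> b" for a b by (rule emb_central)
  show ?thesis
    by unfold_locales
      (auto simp: scaleHom_def fun_eq_iff scale_add_left scale_add_right scale_scale scale_one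
        emb_add emb_mult emb_one comm)
qed

definition commutative_ring :: "'d::division_ring itself \<Rightarrow> bool" where
  "commutative_ring _ \<longleftrightarrow> (\<forall>x y :: 'd. x * y = y * x)"

definition eval_poly :: "('f::field \<Rightarrow> 'd::division_ring) \<Rightarrow> 'f poly \<Rightarrow> 'd \<Rightarrow> 'd" where
  "eval_poly \<iota> p x = (\<Sum>k\<le>degree p. \<iota> (coeff p k) * x ^ k)"

text \<open>Here \<open>p\<close> is, up to a unit, the minimal polynomial of \<open>x\<close>; its roots in an algebraic closure are
  simple exactly when \<open>p\<close> is coprime to its derivative.\<close>

definition separable_extension :: "('f::field \<Rightarrow> 'd::division_ring) \<Rightarrow> bool" where
  "separable_extension \<iota> \<longleftrightarrow> commutative_ring TYPE('d) \<and>
     (\<forall>x. \<exists>p. irreducible p \<and> eval_poly \<iota> p x = 0 \<and> coprime p (pderiv p))"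

definition galois_group :: "('f::field \<Rightarrow> 'd::division_ring) \<Rightarrow> ('d \<Rightarrow> 'd) set" where
  "galois_group \<iota> = {\<tau>. bij \<tau> \<and> (\<forall>x y. \<tau> (x + y) = \<tau> x + \<tau> y) \<and> (\<forall>x y. \<tau> (x * y) = \<tau> x * \<tau> y) \<and>
     (\<forall>c. \<tau> (\<iota> c) = \<iota> c)}"

text \<open>The symbols \<open>(a, b)\<close> and \<open>[a, b)\<close> of the classical description of quaternion algebras in
  characteristic different from \<open>2\<close> and equal to \<open>2\<close>, respectively.\<close>

definition quaternion_basis :: "('f::field \<Rightarrow> 'd::division_ring) \<Rightarrow> 'd \<Rightarrow> 'd \<Rightarrow> bool" where
  "quaternion_basis \<iota> i j \<longleftrightarrow>
     card {1, i, j, i * j} = 4 \<and>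
     \<not> module.dependent (scaleD \<iota>) {1, i, j, i * j} \<and>
     module.span (scaleD \<iota>) {1, i, j, i * j} = UNIV \<and>
     (if CHAR('f) = 2
      then \<exists>a b. b \<noteq> 0 \<and> i * i + i = \<iota> a \<and> j * j = \<iota> b \<and> i * j = j * (i + 1)
      else \<exists>a b. a \<noteq> 0 \<and> b \<noteq> 0 \<and> i * i = \<iota> a \<and> j * j = \<iota> b \<and> i * j = - (j * i))"

definition quaternion_algebra :: "('f::field \<Rightarrow> 'd::division_ring) \<Rightarrow> bool" where
  "quaternion_algebra \<iota> \<longleftrightarrow> (\<exists>i j. quaternion_basis \<iota> i j)"

text \<open>Quaternionic conjugation does not depend on the choice of the basis.\<close>

definition quaternion_conjugation ::
  "('f::field \<Rightarrow> 'd::division_ring) \<Rightarrow> ('d \<Rightarrow> 'd) \<Rightarrow> bool" where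
  "quaternion_conjugation \<iota> \<sigma> \<longleftrightarrow>
     (\<exists>i j. quaternion_basis \<iota> i j \<and>
       (\<forall>t x y z. \<sigma> (\<iota> t + \<iota> x * i + \<iota> y * j + \<iota> z * (i * j)) =
         (if CHAR('f) = 2
          then \<iota> t + \<iota> x * (i + 1) + \<iota> y * j + \<iota> z * (i * j)
          else \<iota> t - \<iota> x * i - \<iota> y * j - \<iota> z * (i * j))))"

text \<open>The four cases of quadratic type, where \<open>d\<close> is the dimension of the division ring. They are
  mutually exclusive.\<close>

definition quadratic_type_1 :: "('f::field \<Rightarrow> 'd::division_ring) \<Rightarrow> nat \<Rightarrow> bool" where
  "quadratic_type_1 \<iota> d \<longleftrightarrow> d = 1"

definition quadratic_type_2 :: "('f::field \<Rightarrow> 'd::division_ring) \<Rightarrow> nat \<Rightarrow> bool" where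
  "quadratic_type_2 \<iota> d \<longleftrightarrow> d = 2 \<and> separable_extension \<iota>"

definition quadratic_type_3 :: "('f::field \<Rightarrow> 'd::division_ring) \<Rightarrow> nat \<Rightarrow> bool" where
  "quadratic_type_3 \<iota> d \<longleftrightarrow> d = 4 \<and> quaternion_algebra \<iota>"

definition quadratic_type_4 :: "('f::field \<Rightarrow> 'd::division_ring) \<Rightarrow> nat \<Rightarrow> bool" where
  "quadratic_type_4 \<iota> d \<longleftrightarrow> (\<exists>m\<ge>1. d = 2 ^ m) \<and> CHAR('f) = 2 \<and>
     commutative_ring TYPE('d) \<and> (\<forall>x. x\<^sup>2 \<in> range \<iota>)"

definition quadratic_type :: "('f::field \<Rightarrow> 'd::division_ring) \<Rightarrow> nat \<Rightarrow> bool" where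
  "quadratic_type \<iota> d \<longleftrightarrow>
     quadratic_type_1 \<iota> d \<or> quadratic_type_2 \<iota> d \<or> quadratic_type_3 \<iota> d \<or> quadratic_type_4 \<iota> d"

definition standard_involution ::
  "('f::field \<Rightarrow> 'd::division_ring) \<Rightarrow> nat \<Rightarrow> ('d \<Rightarrow> 'd) \<Rightarrow> bool" where
  "standard_involution \<iota> d \<sigma> \<longleftrightarrow>
     (quadratic_type_1 \<iota> d \<or> quadratic_type_4 \<iota> d \<longrightarrow> \<sigma> = id) \<and>
     (quadratic_type_2 \<iota> d \<longrightarrow> \<sigma> \<in> galois_group \<iota> \<and> \<sigma> \<noteq> id) \<and>
     (quadratic_type_3 \<iota> d \<longrightarrow> quaternion_conjugation \<iota> \<sigma>)"

definition associated_pair ::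
  "('f::field \<Rightarrow> 'd::division_ring) \<Rightarrow> nat \<Rightarrow> ('d \<Rightarrow> 'd) \<Rightarrow> ('d \<Rightarrow> 'f) \<Rightarrow> bool" where
  "associated_pair \<iota> d \<sigma> e \<longleftrightarrow>
     standard_involution \<iota> d \<sigma> \<and> Vector_Spaces.linear (scaleD \<iota>) (*) e \<and>
     (quadratic_type_1 \<iota> d \<or> quadratic_type_2 \<iota> d \<longrightarrow> (\<forall>x. \<iota> (e x) = (\<Sum>\<tau>\<in>galois_group \<iota>. \<tau> x))) \<and>
     (quadratic_type_3 \<iota> d \<longrightarrow> (\<forall>x. \<iota> (e x) = x + \<sigma> x)) \<and>
     (quadratic_type_4 \<iota> d \<longrightarrow> (\<exists>x. e x \<noteq> 0))"

definition sesquilinear_form ::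
  "('u::ab_group_add \<Rightarrow> 'd::division_ring \<Rightarrow> 'u) \<Rightarrow> ('v::ab_group_add \<Rightarrow> 'd \<Rightarrow> 'v) \<Rightarrow> ('d \<Rightarrow> 'd) \<Rightarrow>
    ('u \<Rightarrow> 'v \<Rightarrow> 'd) \<Rightarrow> bool" where
  "sesquilinear_form sU sV \<sigma> B \<longleftrightarrow>
     (\<forall>\<alpha> x x' y. B (sU x \<alpha> + x') y = \<sigma> \<alpha> * B x y + B x' y) \<and>
     (\<forall>\<alpha> x y y'. B x (sV y \<alpha> + y') = B x y * \<alpha> + B x y')"

definition right_nondegenerate :: "('u \<Rightarrow> 'v::zero \<Rightarrow> 'd::zero) \<Rightarrow> bool" where
  "right_nondegenerate B \<longleftrightarrow> {y. \<forall>x. B x y = 0} = {0}"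

definition alternating_operators ::
  "('u::ab_group_add \<Rightarrow> 'd::division_ring \<Rightarrow> 'u) \<Rightarrow> ('v::ab_group_add \<Rightarrow> 'd \<Rightarrow> 'v) \<Rightarrow>
    ('u \<Rightarrow> 'v \<Rightarrow> 'f::zero) \<Rightarrow> ('u \<Rightarrow> 'v) set" where
  "alternating_operators sU sV b = {f. rlinear sU sV f \<and> (\<forall>x. b x (f x) = 0)}"

text \<open>The target space is an explicit argument, since operators with values in a subspace \<open>W\<close>
  are represented by functions into the ambient space.\<close>

definition intransitive :: "'v set \<Rightarrow> ('u \<Rightarrow> 'v) set \<Rightarrow> bool" where
  "intransitive W S \<longleftrightarrow> (\<forall>x. {f x | f. f \<in> S} \<noteq> W)"

definition deeply_intransitive ::
  "('v::ab_group_add \<Rightarrow> 'd::division_ring \<Rightarrow> 'v) \<Rightarrow> ('u \<Rightarrow> 'v) set \<Rightarrow> bool" where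
  "deeply_intransitive sV S \<longleftrightarrow>
     intransitive UNIV S \<and>
     (\<forall>W. rsubspace sV W \<and> W \<noteq> {0} \<longrightarrow> intransitive W {f \<in> S. range f \<subseteq> W})"

end

theory Submission
  imports Defs
begin

text \<open>
  In all four cases of quadratic type, \<open>\<sigma>\<close> is an anti-involution with \<open>\<sigma> x * x\<close> in the
  central subfield, and \<open>e\<close> is a nonzero, symmetric (\<open>e (x * y) = e (y * x)\<close>) and \<open>\<sigma>\<close>-invariant
  linear form; nothing else about \<open>(\<sigma>, e)\<close> is needed.

  Choose a basis \<open>v\<^sub>i\<close> of \<open>V\<close> and vectors \<open>u\<^sub>i\<close> of \<open>U\<close> with \<open>B (u\<^sub>i) (v\<^sub>j) = \<delta>\<^sub>i\<^sub>j\<close>. An operator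
  \<open>f\<close> is determined by the matrix \<open>a\<^sub>i\<^sub>j = B (u\<^sub>i) (f (u\<^sub>j))\<close>, because an alternating operator vanishes
  on the left radical of \<open>B\<close>. By polarization, \<open>f\<close> is alternating iff \<open>a\<^sub>j\<^sub>i = - \<sigma> a\<^sub>i\<^sub>j\<close> for
  \<open>i \<noteq> j\<close> and \<open>e a\<^sub>i\<^sub>i = 0\<close>, which gives the dimension.

  For deep intransitivity, if \<open>B x\<close> is nonzero on the subspace \<open>W\<close>, then the values \<open>f x\<close> lie in the
  proper subset \<open>e (B x y) = 0\<close> of \<open>W\<close>; if \<open>B x\<close> vanishes on \<open>W\<close>, then polarization forces
  \<open>f x = 0\<close> for every alternating \<open>f\<close> with range in \<open>W\<close>.
\<close>

section \<open>Dimension counts from dual families and from independent sets\<close>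

context vector_space
begin

text \<open>Applying \<open>\<phi> i\<close> to a linear relation among the \<open>g j\<close>
  isolates its \<open>i\<close>-th coefficient, so the family is independent; \<open>expand\<close>
  makes it spanning. This reduces the dimension formula to exhibiting operators together with
  functionals that read off their coordinates.\<close>

lemma has_dimension_dual_family:
  fixes g :: "'i \<Rightarrow> 'b" and \<phi> :: "'i \<Rightarrow> 'b \<Rightarrow> 'a"
  assumes "finite I" "subspace W" and gW: "\<And>i. i \<in> I \<Longrightarrow> g i \<in> W"
    and add: "\<And>i v w. \<phi> i (v + w) = \<phi> i v + \<phi> i w"
    and hom: "\<And>i c v. \<phi> i (scale c v) = c * \<phi> i v"
    and dual: "\<And>i j. i \<in> I \<Longrightarrow> j \<in> I \<Longrightarrow> \<phi> i (g j) = (if i = j then 1 else 0)"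
    and expand: "\<And>w. w \<in> W \<Longrightarrow> w = (\<Sum>i\<in>I. scale (\<phi> i w) (g i))"
  shows "has_dimension scale W (card I)"
proof -
  have zero: "\<phi> i 0 = 0" for i
    using hom[of i 0 0] by simp
  have sum: "\<phi> i (\<Sum>x\<in>X. h x) = (\<Sum>x\<in>X. \<phi> i (h x))" for i and X :: "'i set" and h
    by (induction X rule: infinite_finite_induct) (simp_all add: zero add)
  have inj: "inj_on g I"
    by (rule inj_onI) (metis dual zero_neq_one)
  have "independent (g ` I)"
  proof
    assume "dependent (g ` I)"
    then obtain c i where i: "i \<in> I" "c (g i) \<noteq> 0" and c: "(\<Sum>v\<in>g ` I. scale (c v) v) = 0"
      using dependent_finite[of "g ` I"] \<open>finite I\<close> by auto
    have "0 = \<phi> i (\<Sum>v\<in>g ` I. scale (c v) v)"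
      by (simp add: c zero)
    also have "\<dots> = (\<Sum>j\<in>I. c (g j) * \<phi> i (g j))"
      by (simp add: sum hom sum.reindex[OF inj])
    also have "\<dots> = (\<Sum>j\<in>I. if i = j then c (g j) else 0)"
      by (rule sum.cong) (use i dual in auto)
    also have "\<dots> = c (g i)"
      using i \<open>finite I\<close> by simp
    finally show False
      using i by simp
  qed
  moreover have span: "span (g ` I) = W"
  proof
    show "span (g ` I) \<subseteq> W"
      by (rule span_minimal) (use gW \<open>subspace W\<close> in auto)
    show "W \<subseteq> span (g ` I)"
    proof
      fix w assume "w \<in> W"
      moreover have "(\<Sum>i\<in>I. scale (\<phi> i w) (g i)) \<in> span (g ` I)"
        by (intro span_sum span_scale span_base) auto
      ultimately show "w \<in> span (g ` I)"
        using expand by metis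
    qed
  qed
  ultimately have "dim W = card I"
    using dim_span_eq_card_independent[of "g ` I"] card_image[OF inj] by simp
  moreover have "\<exists>X. finite X \<and> span X = W"
    using span \<open>finite I\<close> by (intro exI[of _ "g ` I"]) simp
  ultimately show ?thesis
    unfolding has_dimension_def using \<open>subspace W\<close> by simp
qed

text \<open>A basis of \<open>W\<close> extending \<open>S\<close> has as many elements as
  \<open>S\<close>, hence equals \<open>S\<close>.\<close>

lemma has_dimension_independent_spans:
  assumes "has_dimension scale W (card S)" "S \<subseteq> W" "independent S"
  shows "W \<subseteq> span S"
proof -
  obtain X where X: "finite X" "span X = W" and dim: "dim W = card S"
    using assms unfolding has_dimension_def by blast
  obtain T where T: "S \<subseteq> T" "T \<subseteq> W" "independent T" "W \<subseteq> span T"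
    using maximal_independent_subset_extend[OF assms(2,3)] by blast
  have "finite T"
    using independent_span_bound[OF X(1) T(3)] T(2) X(2) by blast
  moreover have "card T = card S"
    using basis_card_eq_dim[OF T(2,4,3)] dim by simp
  ultimately have "S = T"
    using T(1) card_subset_eq by metis
  then show ?thesis
    using T by simp
qed

end

section \<open>The embedded scalars and linear forms on the division ring\<close>

context central_subfield
begin

lemma emb_zero [simp]: "\<iota> 0 = 0"
  using emb_add[of 0 0] by simp

lemma emb_minus: "\<iota> (- a) = - \<iota> a"
  using emb_add[of a "- a"] by (simp add: eq_neg_iff_add_eq_0 add.commute)

lemma emb_diff: "\<iota> (a - b) = \<iota> a - \<iota> b"
  using emb_add[of a "- b"] by (simp add: emb_minus)

lemma emb_nonzero: "a \<noteq> 0 \<Longrightarrow> \<iota> a \<noteq> 0"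
  by (metis emb_mult emb_one emb_zero mult_zero_left right_inverse zero_neq_one)

lemma emb_eq_iff: "\<iota> a = \<iota> b \<longleftrightarrow> a = b"
  using emb_nonzero[of "a - b"] by (auto simp: emb_diff)

lemma central_elem:
  assumes "z \<in> range \<iota>"
  shows "z * x = x * z"
  using assms emb_central by auto

lemmas emb_simps = emb_add emb_mult emb_one emb_minus emb_diff

lemma linear_form_add:
  assumes "Vector_Spaces.linear (scaleD \<iota>) (*) e"
  shows "e (x + y) = e x + e y"
proof -
  interpret Vector_Spaces.linear "scaleD \<iota>" "(*)" e by fact
  show ?thesis by (rule add)
qed

lemma linear_form_scale:
  assumes "Vector_Spaces.linear (scaleD \<iota>) (*) e"
  shows "e (\<iota> c * x) = c * e x"
proof -
  interpret Vector_Spaces.linear "scaleD \<iota>" "(*)" e by fact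
  show ?thesis using scale[of c x] by (simp add: scaleD_def)
qed

end

section \<open>Abstract properties of an associated pair\<close>

text \<open>The relation \<open>\<iota> (e x) = x + \<sigma> x\<close> cannot be among the axioms:
  it fails in the cases where \<open>\<sigma> = id\<close>.\<close>

locale trace_pair = central_subfield \<iota>
  for \<iota> :: "'f::field \<Rightarrow> 'd::division_ring" +
  fixes \<sigma> :: "'d \<Rightarrow> 'd" and e :: "'d \<Rightarrow> 'f"
  assumes \<sigma>_add: "\<sigma> (x + y) = \<sigma> x + \<sigma> y"
    and \<sigma>_mult: "\<sigma> (x * y) = \<sigma> y * \<sigma> x"
    and \<sigma>_\<sigma> [simp]: "\<sigma> (\<sigma> x) = x"
    and \<sigma>_emb: "\<sigma> (\<iota> c) = \<iota> c"
    and norm: "\<sigma> x * x \<in> range \<iota>"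
    and e_linear: "Vector_Spaces.linear (scaleD \<iota>) (*) e"
    and e_\<sigma>: "e (\<sigma> x) = e x"
    and e_commute: "e (x * y) = e (y * x)"
    and e_nonzero: "\<exists>x. e x \<noteq> 0"
begin

lemma e_add: "e (x + y) = e x + e y"
  by (rule linear_form_add[OF e_linear])

lemma e_scale: "e (\<iota> c * x) = c * e x"
  by (rule linear_form_scale[OF e_linear])

lemma e_zero [simp]: "e 0 = 0"
  using e_scale[of 0 0] by simp

lemma e_minus: "e (- x) = - e x"
  using e_add[of x "- x"] by (simp add: eq_neg_iff_add_eq_0 add.commute)

lemma e_diff: "e (x - y) = e x - e y"
  using e_add[of x "- y"] by (simp add: e_minus)

lemma \<sigma>_zero [simp]: "\<sigma> 0 = 0"
  using \<sigma>_add[of 0 0] by simp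

lemma \<sigma>_one [simp]: "\<sigma> 1 = 1"
  using \<sigma>_emb[of 1] by (simp add: emb_one)

text \<open>Symmetry of \<open>e\<close> brings \<open>\<sigma> x\<close> next to \<open>x\<close>,
  and the scalar \<open>\<sigma> x * x\<close> then leaves \<open>e\<close>. This is what makes the
  diagonal matrix units alternating.\<close>

lemma e_conjugate:
  assumes "e a = 0"
  shows "e (x * a * \<sigma> x) = 0"
proof -
  obtain c where c: "\<sigma> x * x = \<iota> c"
    using norm by blast
  have "e (x * a * \<sigma> x) = e (\<sigma> x * x * a)"
    using e_commute[of "x * a" "\<sigma> x"] by (simp add: mult.assoc)
  then show ?thesis
    using assms by (simp add: c e_scale)
qed

text \<open>Taking \<open>t = a / z\<close> with \<open>e a \<noteq> 0\<close> excludes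
  \<open>z \<noteq> 0\<close>. Identities known only after applying \<open>e\<close> are lifted to
  the division ring by this lemma.\<close>

lemma e_nondegenerate:
  assumes "\<And>t. e (t * z) = 0"
  shows "z = 0"
proof (rule ccontr)
  assume "z \<noteq> 0"
  obtain a where "e a \<noteq> 0"
    using e_nonzero by blast
  then show False
    using assms[of "a * inverse z"] \<open>z \<noteq> 0\<close> by (simp add: mult.assoc)
qed

text \<open>\<open>K\<close> is a basis of the kernel of \<open>e\<close>, \<open>a0\<close>
  completes it to a basis of the division ring, and \<open>\<gamma>\<close> gives the coordinates.
  Diagonal matrix entries will use \<open>K\<close> alone, off-diagonal ones the whole
  basis.\<close>

lemma adapted_coordinates:
  assumes "has_dimension (scaleD \<iota>) UNIV d"
  obtains K a0 \<gamma> where "finite K" "card K = d - 1" "d > 0" "a0 \<notin> K"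
    "\<And>k. k \<in> K \<Longrightarrow> e k = 0"
    "\<And>k a b. \<gamma> k (a + b) = (\<gamma> k a + \<gamma> k b :: 'f)"
    "\<And>k c a. \<gamma> k (\<iota> c * a) = c * \<gamma> k a"
    "\<And>k l. k \<in> insert a0 K \<Longrightarrow> l \<in> insert a0 K \<Longrightarrow> \<gamma> k l = (if k = l then 1 else 0)"
    "\<And>a. (\<Sum>k\<in>insert a0 K. \<iota> (\<gamma> k a) * k) = a"
    "\<And>a. e a = 0 \<Longrightarrow> \<gamma> a0 a = 0"
proof -
  interpret vs: vector_space "scaleD \<iota>" by (rule vector_space_scaleD)
  obtain X where X: "finite X" "vs.span X = UNIV" and d: "vs.dim UNIV = d"
    using assms unfolding has_dimension_def by blast
  have sub: "vs.subspace {a. e a = 0}"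
    by (auto simp: vs.subspace_def e_add scaleD_def e_scale)
  obtain K where K: "K \<subseteq> {a. e a = 0}" "vs.independent K" "{a. e a = 0} \<subseteq> vs.span K"
    using vs.maximal_independent_subset by blast
  have spanK: "vs.span K = {a. e a = 0}"
    using K sub vs.span_minimal by blast
  obtain a1 where a1: "e a1 \<noteq> 0"
    using e_nonzero by blast
  define L where "L = insert a1 K"
  have a1K: "a1 \<notin> vs.span K"
    using a1 spanK by simp
  then have notin: "a1 \<notin> K"
    using vs.span_base by blast
  have indep: "vs.independent L"
    unfolding L_def using K a1K by (simp add: vs.independent_insert)
  have "a \<in> vs.span L" for a
  proof -
    define c where "c = e a / e a1"
    have "e (a - \<iota> c * a1) = 0"
      using a1 by (simp add: e_diff e_scale c_def)
    then have "a - \<iota> c * a1 \<in> vs.span L"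
      using spanK vs.span_mono[of K L] by (auto simp: L_def)
    moreover have "\<iota> c * a1 \<in> vs.span L"
      using vs.span_scale[OF vs.span_base, of a1 L c] by (simp add: scaleD_def L_def)
    ultimately show ?thesis
      using vs.span_add by fastforce
  qed
  then have spanL: "vs.span L = UNIV"
    by blast
  have finL: "finite L"
    using vs.independent_span_bound[OF X(1) indep] X by simp
  have "d = card L"
    using vs.dim_eq_card[OF _ indep, of UNIV] d spanL by simp
  then have card: "card K = d - 1" "d > 0"
    using finL notin by (auto simp: L_def)
  define \<gamma> where "\<gamma> k a = vs.representation L a k" for k a
  have add: "\<gamma> k (a + b) = \<gamma> k a + \<gamma> k b" for k a b
    by (simp add: \<gamma>_def vs.representation_add indep spanL)
  have scale: "\<gamma> k (\<iota> c * a) = c * \<gamma> k a" for k c a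
    using vs.representation_scale[OF indep, of a c] spanL by (simp add: \<gamma>_def scaleD_def)
  have dual: "\<gamma> k l = (if k = l then 1 else 0)" if "k \<in> L" "l \<in> L" for k l
    using that vs.representation_basis[OF indep, of l] by (auto simp: \<gamma>_def)
  have expand: "(\<Sum>k\<in>L. \<iota> (\<gamma> k a) * k) = a" for a
    using vs.sum_representation_eq[OF indep, of a L] finL spanL by (simp add: \<gamma>_def scaleD_def)
  have ker: "\<gamma> a1 a = 0" if "e a = 0" for a
  proof -
    have esum: "e (\<Sum>k\<in>M. h k) = (\<Sum>k\<in>M. e (h k))" for h :: "'d \<Rightarrow> 'd" and M :: "'d set"
      by (induction M rule: infinite_finite_induct) (simp_all add: e_add)
    \<comment> \<open>Applying \<open>e\<close> to the expansion of \<open>a\<close> kills every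
      term except the one at \<open>a1\<close>.\<close>
    have "0 = (\<Sum>k\<in>L. \<gamma> k a * e k)"
      using expand[of a] that esum[of "\<lambda>k. \<iota> (\<gamma> k a) * k" L] by (simp add: e_scale)
    also have "\<dots> = \<gamma> a1 a * e a1"
      using K(1) finL notin by (auto simp: L_def intro!: sum.neutral)
    finally show ?thesis
      using a1 by simp
  qed
  show thesis
  proof (rule that[of K a1 \<gamma>])
    show "finite K" using finL by (simp add: L_def)
    show "e k = 0" if "k \<in> K" for k using that K by auto
  qed (assumption | rule card notin add scale dual[unfolded L_def] expand[unfolded L_def] ker)+
qed

end

section \<open>The trace pair axioms in the four cases of quadratic type\<close>

text \<open>Common core of the separable quadratic and the quaternion case: there \<open>e\<close>
  is \<open>x + \<sigma> x\<close>, so its symmetry, invariance and nontriviality all follow from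
  properties of \<open>\<sigma>\<close>.\<close>

lemma (in central_subfield) trace_pair_of_reduced_trace:
  assumes "\<And>x y. \<sigma> (x + y) = \<sigma> x + \<sigma> y"
    and "\<And>x y. \<sigma> (x * y) = \<sigma> y * \<sigma> x"
    and invol: "\<And>x. \<sigma> (\<sigma> x) = x"
    and emb: "\<And>c. \<sigma> (\<iota> c) = \<iota> c"
    and norm: "\<And>x. \<sigma> x * x \<in> range \<iota>"
    and lin: "Vector_Spaces.linear (scaleD \<iota>) (*) e"
    and tr: "\<And>x. \<iota> (e x) = x + \<sigma> x"
    and "\<sigma> \<noteq> id"
  shows "trace_pair \<iota> \<sigma> e"
proof (intro trace_pair.intro trace_pair_axioms.intro)
  show e_\<sigma>: "e (\<sigma> x) = e x" for x
    using tr[of "\<sigma> x"] tr[of x] by (simp add: invol add.commute emb_eq_iff[symmetric])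
  have norm': "x * \<sigma> x = \<sigma> x * x" for x
  proof (cases "x = 0")
    case False
    \<comment> \<open>The norm \<open>\<sigma> x * x\<close> is central; the right factor
      \<open>x\<close> is cancelled afterwards.\<close>
    have "x * \<sigma> x * x = \<sigma> x * x * x"
      using central_elem[OF norm, of x x] by (simp add: mult.assoc)
    then show ?thesis
      using False by simp
  qed simp
  \<comment> \<open>Polarizing \<open>x * \<sigma> x = \<sigma> x * x\<close> yields the symmetry of the trace.\<close>
  have *: "e (x * \<sigma> y) = e (\<sigma> x * y)" for x y
  proof -
    have "x * \<sigma> y + y * \<sigma> x = \<sigma> x * y + \<sigma> y * x"
      using norm'[of "x + y"] norm'[of x] norm'[of y] by (simp add: assms(1) algebra_simps)
    then have "x * \<sigma> y + \<sigma> (x * \<sigma> y) = \<sigma> x * y + \<sigma> (\<sigma> x * y)"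
      by (simp add: assms(2) invol)
    then show ?thesis
      by (simp add: tr[symmetric] emb_eq_iff)
  qed
  show "e (x * y) = e (y * x)" for x y
  proof -
    have "e (x * y) = e (\<sigma> x * \<sigma> y)"
      using *[of x "\<sigma> y"] by (simp add: invol)
    also have "\<dots> = e (\<sigma> (y * x))"
      by (simp add: assms(2))
    finally show ?thesis
      by (simp add: e_\<sigma>)
  qed
  show "\<exists>x. e x \<noteq> 0"
  proof (rule ccontr)
    assume "\<not> (\<exists>x. e x \<noteq> 0)"
    then have neg: "\<sigma> x = - x" for x
      using tr[of x] by (simp add: eq_neg_iff_add_eq_0 add.commute)
    \<comment> \<open>If \<open>e\<close> were zero, \<open>\<sigma>\<close> would be negation;
      since it fixes \<open>1\<close>, negation is the identity, contradicting
      \<open>\<sigma> \<noteq> id\<close>.\<close>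
    have "- 1 = (1 :: 'd)"
      using neg[of 1] emb[of 1] by (simp add: emb_one)
    then have "\<sigma> x = x" for x
      using neg[of x] mult_minus1[of x] by simp
    then show False
      using \<open>\<sigma> \<noteq> id\<close> by auto
  qed
qed (rule central_subfield_axioms assms)+

lemma (in central_subfield) dimension_one_range:
  assumes "has_dimension (scaleD \<iota>) UNIV 1"
  shows "range \<iota> = UNIV"
proof -
  interpret vs: vector_space "scaleD \<iota>" by (rule vector_space_scaleD)
  have "UNIV \<subseteq> vs.span {1}"
    using assms by (intro vs.has_dimension_independent_spans) auto
  then show ?thesis
    by (auto simp: vs.span_singleton scaleD_def)
qed

lemma (in central_subfield) dimension_two_basis:
  assumes "has_dimension (scaleD \<iota>) UNIV 2" and "\<theta> \<notin> range \<iota>"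
  shows "\<exists>a b. x = \<iota> a + \<iota> b * \<theta>"
proof -
  interpret vs: vector_space "scaleD \<iota>" by (rule vector_space_scaleD)
  have \<theta>: "\<theta> \<notin> vs.span {1}"
    using assms by (auto simp: vs.span_singleton scaleD_def)
  then have "\<theta> \<noteq> 1"
    using vs.span_base by fastforce
  have "vs.independent {\<theta>, 1}"
    using \<theta> \<open>\<theta> \<noteq> 1\<close> by (simp add: vs.independent_insert)
  then have "UNIV \<subseteq> vs.span {\<theta>, 1}"
    using assms(1) \<open>\<theta> \<noteq> 1\<close> by (intro vs.has_dimension_independent_spans) (auto simp: numeral_2_eq_2)
  then have "x \<in> vs.span {\<theta>, 1}"
    by blast
  then obtain k where "x - scaleD \<iota> k \<theta> \<in> vs.span {1}"
    by (auto simp: vs.span_insert)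
  then obtain a where "x - scaleD \<iota> k \<theta> = \<iota> a"
    by (auto simp: vs.span_singleton scaleD_def)
  then show ?thesis
    by (metis diff_eq_eq scaleD_def)
qed

text \<open>For \<open>\<theta>\<close> moved by \<open>\<sigma>\<close>, every automorphism sends
  \<open>\<theta>\<close> to a root of its quadratic polynomial and is determined by that root.
  Hence the Galois group is \<open>{id, \<sigma>}\<close> and the Galois trace is
  \<open>x + \<sigma> x\<close>. Norms are scalars because \<open>\<sigma>\<close> fixes them and
  its fixed elements are scalars.\<close>

lemma (in central_subfield) trace_pair_quadratic:
  assumes dim: "has_dimension (scaleD \<iota>) UNIV 2" and comm: "commutative_ring TYPE('d)"
    and \<sigma>: "\<sigma> \<in> galois_group \<iota>" "\<sigma> \<noteq> id"
    and lin: "Vector_Spaces.linear (scaleD \<iota>) (*) e"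
    and tr: "\<And>x. \<iota> (e x) = (\<Sum>\<tau>\<in>galois_group \<iota>. \<tau> x)"
  shows "trace_pair \<iota> \<sigma> e"
proof -
  have comm: "x * y = y * x" for x y :: 'd
    using comm by (simp add: commutative_ring_def)
  obtain \<theta> where \<theta>: "\<sigma> \<theta> \<noteq> \<theta>"
    using \<open>\<sigma> \<noteq> id\<close> by fastforce
  have \<theta>F: "\<theta> \<notin> range \<iota>"
    using \<theta> \<sigma> by (auto simp: galois_group_def)
  note basis = dimension_two_basis[OF dim \<theta>F]
  obtain q p where pq: "\<theta> * \<theta> = \<iota> q + \<iota> p * \<theta>"
    using basis by blast
  have gal: "\<tau> (x + y) = \<tau> x + \<tau> y" "\<tau> (x * y) = \<tau> x * \<tau> y" "\<tau> (\<iota> c) = \<iota> c"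
    if "\<tau> \<in> galois_group \<iota>" for \<tau> x y c
    using that by (auto simp: galois_group_def)
  have roots: "\<tau> \<theta> = \<theta> \<or> \<tau> \<theta> = \<iota> p - \<theta>" if "\<tau> \<in> galois_group \<iota>" for \<tau>
  proof -
    have "\<tau> \<theta> * \<tau> \<theta> = \<iota> q + \<iota> p * \<tau> \<theta>"
      using arg_cong[OF pq, of \<tau>] by (simp add: gal[OF that])
    \<comment> \<open>The two roots of the polynomial \<open>X^2 - p X - q\<close> of
      \<open>\<theta>\<close> have sum \<open>p\<close>, so the second one is
      \<open>\<iota> p - \<theta>\<close>.\<close>
    moreover have "(\<tau> \<theta> - \<theta>) * (\<tau> \<theta> - (\<iota> p - \<theta>)) =
        \<tau> \<theta> * \<tau> \<theta> - \<iota> p * \<tau> \<theta> - (\<theta> * \<theta> - \<iota> p * \<theta>)"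
      using comm[of "\<tau> \<theta>" "\<iota> p"] comm[of "\<theta>" "\<iota> p"] comm[of "\<tau> \<theta>" \<theta>]
      by (simp add: algebra_simps)
    ultimately have "(\<tau> \<theta> - \<theta>) * (\<tau> \<theta> - (\<iota> p - \<theta>)) = 0"
      by (simp add: pq)
    then show ?thesis
      by simp
  qed
  have determined: "\<tau> = \<tau>'"
    if "\<tau> \<in> galois_group \<iota>" "\<tau>' \<in> galois_group \<iota>" "\<tau> \<theta> = \<tau>' \<theta>" for \<tau> \<tau>'
  proof
    fix x
    obtain a b where "x = \<iota> a + \<iota> b * \<theta>"
      using basis by blast
    then show "\<tau> x = \<tau>' x"
      by (simp add: gal[OF that(1)] gal[OF that(2)] that(3))
  qed
  have id: "id \<in> galois_group \<iota>"
    by (simp add: galois_group_def)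
  have \<sigma>\<theta>: "\<sigma> \<theta> = \<iota> p - \<theta>"
    using roots[OF \<sigma>(1)] \<theta> by blast
  have "\<tau> = id \<or> \<tau> = \<sigma>" if "\<tau> \<in> galois_group \<iota>" for \<tau>
    using roots[OF that] determined[OF that id] determined[OF that \<sigma>(1)] \<sigma>\<theta> by auto
  then have "galois_group \<iota> = {id, \<sigma>}"
    using id \<sigma>(1) by blast
  then have tr': "\<iota> (e x) = x + \<sigma> x" for x
    using tr[of x] \<sigma>(2) by simp
  have "\<sigma> (\<iota> p - \<theta>) + \<sigma> \<theta> = \<iota> p"
    by (metis gal(1,3)[OF \<sigma>(1)] diff_add_cancel)
  then have *: "\<sigma> (\<iota> p - \<theta>) = \<theta>"
    by (simp add: \<sigma>\<theta> algebra_simps)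
  have invol: "\<sigma> (\<sigma> x) = x" for x
  proof -
    obtain a b where "x = \<iota> a + \<iota> b * \<theta>"
      using basis by blast
    then show ?thesis
      by (simp add: gal[OF \<sigma>(1)] \<sigma>\<theta> *)
  qed
  have fixed: "x \<in> range \<iota>" if "\<sigma> x = x" for x
  proof -
    obtain a b where x: "x = \<iota> a + \<iota> b * \<theta>"
      using basis by blast
    then have "\<iota> b * (\<sigma> \<theta> - \<theta>) = 0"
      using that by (simp add: gal[OF \<sigma>(1)] right_diff_distrib)
    then have "\<iota> b = 0"
      using \<theta> by simp
    then show ?thesis
      using x by simp
  qed
  show ?thesis
  proof (rule trace_pair_of_reduced_trace)
    show "\<sigma> x * x \<in> range \<iota>" for x
      by (rule fixed) (simp only: gal(2)[OF \<sigma>(1)] invol comm[of x])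
    show "\<sigma> (x * y) = \<sigma> y * \<sigma> x" for x y
      by (simp only: gal(2)[OF \<sigma>(1)] comm[of "\<sigma> x"])
  qed (rule gal(1)[OF \<sigma>(1)] gal(3)[OF \<sigma>(1)] invol lin tr' \<sigma>(2))+
qed

lemma (in central_subfield) quaternion_basis_span:
  assumes "quaternion_basis \<iota> i j"
  shows "\<exists>t x y z. w = \<iota> t + \<iota> x * i + \<iota> y * j + \<iota> z * (i * j)"
proof -
  interpret vs: vector_space "scaleD \<iota>" by (rule vector_space_scaleD)
  have "w \<in> vs.span {i * j, j, i, 1}"
    using assms unfolding quaternion_basis_def by (simp add: insert_commute)
  then obtain z y x t
    where "w - scaleD \<iota> z (i * j) - scaleD \<iota> y j - scaleD \<iota> x i - scaleD \<iota> t 1 = 0"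
    by (auto simp: vs.span_insert vs.span_empty)
  then have "w = \<iota> t + \<iota> x * i + \<iota> y * j + \<iota> z * (i * j)"
    by (simp add: scaleD_def algebra_simps)
  then show ?thesis
    by blast
qed

text \<open>With \<open>\<epsilon> = 1\<close> in characteristic \<open>2\<close> and \<open>\<epsilon> = 0\<close> otherwise, both presentations of a
  quaternion algebra have the same shape.\<close>

lemma (in central_subfield) quaternion_conjugation_uniform:
  assumes "quaternion_conjugation \<iota> \<sigma>"
  obtains i j \<epsilon> a b where "quaternion_basis \<iota> i j" "i * i = \<iota> \<epsilon> * i + \<iota> a" "j * j = \<iota> b"
    "i * j = j * (\<iota> \<epsilon> - i)" "\<iota> \<epsilon> - i \<noteq> i"
    "\<And>t x y z. \<sigma> (\<iota> t + \<iota> x * i + \<iota> y * j + \<iota> z * (i * j)) =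
      \<iota> (t + x * \<epsilon>) + \<iota> (- x) * i + \<iota> (- y) * j + \<iota> (- z) * (i * j)"
proof -
  obtain i j where ij: "quaternion_basis \<iota> i j"
    and \<sigma>: "\<And>t x y z. \<sigma> (\<iota> t + \<iota> x * i + \<iota> y * j + \<iota> z * (i * j)) =
         (if CHAR('f) = 2
          then \<iota> t + \<iota> x * (i + 1) + \<iota> y * j + \<iota> z * (i * j)
          else \<iota> t - \<iota> x * i - \<iota> y * j - \<iota> z * (i * j))"
    using assms unfolding quaternion_conjugation_def by blast
  show thesis
  proof (cases "CHAR('f) = 2")
    case True
    then have "(1 :: 'f) + 1 = 0"
      using of_nat_CHAR[where 'a = 'f] by simp
    then have neg_f: "- x = x" for x :: 'f
      by (metis add.inverse_unique distrib_left mult.right_neutral mult_zero_right)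
    have neg: "- x = x" for x :: 'd
      using emb_minus[of 1] neg_f[of 1] mult_minus1[of x] by (simp add: emb_one)
    obtain a b where ab: "i * i + i = \<iota> a" "j * j = \<iota> b" "i * j = j * (i + 1)"
      using ij True unfolding quaternion_basis_def by auto
    show ?thesis
    proof (rule that[of i j 1 a b])
      show "i * i = \<iota> 1 * i + \<iota> a"
        using ab(1) neg[of i] by (metis add.commute add_diff_cancel_right' diff_conv_add_uminus emb_one mult_1)
      show "i * j = j * (\<iota> 1 - i)"
        using ab(3) neg[of i] by (metis add.commute diff_conv_add_uminus emb_one)
      show "\<iota> 1 - i \<noteq> i"
        using neg[of i] by (metis add_cancel_left_left diff_conv_add_uminus emb_one zero_neq_one)
      show "\<sigma> (\<iota> t + \<iota> x * i + \<iota> y * j + \<iota> z * (i * j)) =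
          \<iota> (t + x * 1) + \<iota> (- x) * i + \<iota> (- y) * j + \<iota> (- z) * (i * j)" for t x y z
        unfolding \<sigma> using True by (simp add: neg_f emb_add emb_one distrib_left add.assoc add.left_commute)
    qed (use ij ab in auto)
  next
    case False
    have two: "(2 :: 'f) \<noteq> 0"
    proof
      assume "(2 :: 'f) = 0"
      then have "CHAR('f) dvd 2"
        using of_nat_eq_0_iff_char_dvd[where 'a = 'f, of 2] by simp
      then have "CHAR('f) = 1 \<or> CHAR('f) = 2"
        using two_is_prime_nat unfolding prime_nat_iff by blast
      then show False
        using False CHAR_not_1[where 'a = 'f] by simp
    qed
    obtain a b where ab: "a \<noteq> 0" "i * i = \<iota> a" "j * j = \<iota> b" "i * j = - (j * i)"
      using ij False unfolding quaternion_basis_def by auto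
    show ?thesis
    proof (rule that[of i j 0 a b])
      \<comment> \<open>Here \<open>a \<noteq> 0\<close> enters; with \<open>2 \<noteq> 0\<close> it
        shows that conjugation moves \<open>i\<close>.\<close>
      have "i \<noteq> 0"
        using ab emb_nonzero by auto
      moreover have "i + i = \<iota> 2 * i"
        using emb_add[of 1 1] by (simp add: emb_one mult_2)
      ultimately show "\<iota> 0 - i \<noteq> i"
        using emb_nonzero[OF two] by (auto simp: neg_eq_iff_add_eq_0)
      show "\<sigma> (\<iota> t + \<iota> x * i + \<iota> y * j + \<iota> z * (i * j)) =
          \<iota> (t + x * 0) + \<iota> (- x) * i + \<iota> (- y) * j + \<iota> (- z) * (i * j)" for t x y z
        unfolding \<sigma> using False by (simp add: emb_minus)
    qed (use ij ab in simp_all)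
  qed
qed

text \<open>Only multiplication by \<open>i\<close> and by \<open>j\<close> is computed in
  coordinates. The laws for \<open>\<sigma>\<close> and the norm then spread to all elements,
  because the elements satisfying them are closed under sums and products and contain the scalars,
  \<open>i\<close> and \<open>j\<close>.\<close>

lemma (in central_subfield) trace_pair_quaternion:
  assumes conj: "quaternion_conjugation \<iota> \<sigma>"
    and lin: "Vector_Spaces.linear (scaleD \<iota>) (*) e"
    and tr: "\<And>x. \<iota> (e x) = x + \<sigma> x"
  shows "trace_pair \<iota> \<sigma> e"
proof -
  obtain i j \<epsilon> a b where ij: "quaternion_basis \<iota> i j"
    and ii: "i * i = \<iota> \<epsilon> * i + \<iota> a" and jj: "j * j = \<iota> b"
    and ij_ji: "i * j = j * (\<iota> \<epsilon> - i)" and \<sigma>i_neq: "\<iota> \<epsilon> - i \<noteq> i"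
    and \<sigma>_coord: "\<And>t x y z. \<sigma> (\<iota> t + \<iota> x * i + \<iota> y * j + \<iota> z * (i * j)) =
      \<iota> (t + x * \<epsilon>) + \<iota> (- x) * i + \<iota> (- y) * j + \<iota> (- z) * (i * j)"
    using quaternion_conjugation_uniform[OF conj] by metis
  define Q where "Q t x y z = \<iota> t + \<iota> x * i + \<iota> y * j + \<iota> z * (i * j)" for t x y z
  have Q: "\<exists>t x y z. w = Q t x y z" for w
    unfolding Q_def by (rule quaternion_basis_span[OF ij])
  have \<sigma>Q: "\<sigma> (Q t x y z) = Q (t + x * \<epsilon>) (- x) (- y) (- z)" for t x y z
    by (simp only: Q_def \<sigma>_coord)
  have Q_add: "Q t x y z + Q t' x' y' z' = Q (t + t') (x + x') (y + y') (z + z')"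
    for t x y z t' x' y' z'
    by (simp add: Q_def emb_add distrib_right add.assoc add.left_commute)
  have Q_minus: "- Q t x y z = Q (- t) (- x) (- y) (- z)" for t x y z
    by (simp add: Q_def emb_minus algebra_simps)
  have Q_diff: "Q t x y z - Q t' x' y' z' = Q (t - t') (x - x') (y - y') (z - z')"
    for t x y z t' x' y' z'
    using Q_add[of "t - t'" "x - x'" "y - y'" "z - z'" t' x' y' z'] by (simp add: diff_eq_eq)
  have Q_scale: "\<iota> c * Q t x y z = Q (c * t) (c * x) (c * y) (c * z)" for c t x y z
    by (simp add: Q_def emb_mult distrib_left mult.assoc)
  have Q_scale': "Q t x y z * \<iota> c = Q (c * t) (c * x) (c * y) (c * z)" for c t x y z
    using emb_central[of c "Q t x y z"] by (simp only: Q_scale)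
  have ji: "j * i = \<iota> \<epsilon> * j - i * j"
    using ij_ji emb_central[of \<epsilon> j] by (simp add: right_diff_distrib)
  \<comment> \<open>Rules for a normal form: scalars move to the left, \<open>j\<close> moves to the
    right of \<open>i\<close>, and squares of \<open>i\<close> and \<open>j\<close> are
    reduced.\<close>
  have left: "i * \<iota> c = \<iota> c * i" "i * (\<iota> c * w) = \<iota> c * (i * w)"
    "j * \<iota> c = \<iota> c * j" "j * (\<iota> c * w) = \<iota> c * (j * w)" for c w
    using emb_central[of c i] emb_central[of c j] by (metis mult.assoc)+
  have expand: "i * (i * w) = \<iota> \<epsilon> * (i * w) + \<iota> a * w" "j * (j * w) = \<iota> b * w"
    "j * (i * w) = \<iota> \<epsilon> * (j * w) - i * (j * w)" for w
    using arg_cong[OF ii, of "\<lambda>u. u * w"] arg_cong[OF jj, of "\<lambda>u. u * w"]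
      arg_cong[OF ji, of "\<lambda>u. u * w"] by (simp_all add: algebra_simps)
  have emb_mult': "\<iota> c * (\<iota> c' * w) = \<iota> (c * c') * w" "\<iota> c * \<iota> c' = \<iota> (c * c')" for c c' w
    by (simp_all add: emb_mult mult.assoc)
  note norm_simps = distrib_left distrib_right left_diff_distrib right_diff_distrib mult.assoc
    left expand ii jj ji emb_mult' emb_add emb_minus emb_diff mult.commute[where 'a = 'f]
    mult.left_commute[where 'a = 'f]
  have iQ: "i * Q t x y z = Q (x * a) (t + x * \<epsilon>) (z * a) (y + z * \<epsilon>)" for t x y z
    by (simp add: Q_def norm_simps)
  have jQ: "j * Q t x y z = Q (y * b + z * \<epsilon> * b) (- (z * b)) (t + x * \<epsilon>) (- x)" for t x y z
    by (simp add: Q_def norm_simps)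
  have Qi: "Q t x y z * i = Q (x * a) (t + x * \<epsilon>) (y * \<epsilon> - z * a) (- y)" for t x y z
    by (simp add: Q_def norm_simps)
  have Qj: "Q t x y z * j = Q (y * b) (z * b) t x" for t x y z
    by (simp add: Q_def norm_simps)
  have \<sigma>_add: "\<sigma> (x + y) = \<sigma> x + \<sigma> y" for x y
  proof -
    obtain t1 x1 y1 z1 t2 x2 y2 z2 where "x = Q t1 x1 y1 z1" "y = Q t2 x2 y2 z2"
      using Q by metis
    then show ?thesis
      by (simp add: Q_add \<sigma>Q algebra_simps)
  qed
  have invol: "\<sigma> (\<sigma> x) = x" for x
  proof -
    obtain t1 x1 y1 z1 where "x = Q t1 x1 y1 z1"
      using Q by metis
    then show ?thesis
      by (simp add: \<sigma>Q)
  qed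
  have \<sigma>_emb: "\<sigma> (\<iota> c) = \<iota> c" for c
    using \<sigma>Q[of c 0 0 0] by (simp add: Q_def)
  have \<sigma>i: "\<sigma> i = \<iota> \<epsilon> - i"
    using \<sigma>Q[of 0 1 0 0] by (simp add: Q_def emb_simps)
  have \<sigma>j: "\<sigma> j = - j"
    using \<sigma>Q[of 0 0 1 0] by (simp add: Q_def emb_simps)
  have generate: "w \<in> S"
    if "range \<iota> \<subseteq> S" "i \<in> S" "j \<in> S" "\<And>u v. u \<in> S \<Longrightarrow> v \<in> S \<Longrightarrow> u + v \<in> S"
      "\<And>u v. u \<in> S \<Longrightarrow> v \<in> S \<Longrightarrow> u * v \<in> S" for S w
  proof -
    have "Q t x y z \<in> S" for t x y z
      unfolding Q_def using that(1) by (intro that(2-5)) auto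
    then show ?thesis
      using Q by metis
  qed
  have \<sigma>_mult: "\<sigma> (u * v) = \<sigma> v * \<sigma> u" for u v
  proof -
    \<comment> \<open>Quantifying over all \<open>v\<close> inside the set is what makes it closed
      under products.\<close>
    have "u \<in> {u. \<forall>v. \<sigma> (u * v) = \<sigma> v * \<sigma> u}"
    proof (rule generate)
      show "range \<iota> \<subseteq> {u. \<forall>v. \<sigma> (u * v) = \<sigma> v * \<sigma> u}"
      proof clarify
        fix c v
        obtain t x y z where "v = Q t x y z"
          using Q by metis
        then show "\<sigma> (\<iota> c * v) = \<sigma> v * \<sigma> (\<iota> c)"
          by (simp add: \<sigma>_emb \<sigma>Q Q_scale Q_scale' distrib_left mult.assoc)
      qed
      show "i \<in> {u. \<forall>v. \<sigma> (u * v) = \<sigma> v * \<sigma> u}"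
      proof clarify
        fix v
        obtain t x y z where "v = Q t x y z"
          using Q by metis
        then show "\<sigma> (i * v) = \<sigma> v * \<sigma> i"
          by (simp add: \<sigma>i \<sigma>Q iQ Qi right_diff_distrib Q_scale' Q_diff)
            (simp add: algebra_simps minus_diff_commute)
      qed
      show "j \<in> {u. \<forall>v. \<sigma> (u * v) = \<sigma> v * \<sigma> u}"
      proof clarify
        fix v
        obtain t x y z where "v = Q t x y z"
          using Q by metis
        then show "\<sigma> (j * v) = \<sigma> v * \<sigma> j"
          by (simp add: \<sigma>j \<sigma>Q jQ Qj Q_minus algebra_simps)
      qed
    qed (auto simp: \<sigma>_add algebra_simps)
    then show ?thesis
      by blast
  qed
  have norm: "\<sigma> x * x \<in> range \<iota>" for x
  proof -
    have "x \<in> {x. \<sigma> x * x \<in> range \<iota>}"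
    proof (rule generate)
      show "range \<iota> \<subseteq> {x. \<sigma> x * x \<in> range \<iota>}"
        by (auto simp: \<sigma>_emb emb_mult'(2))
      have "\<sigma> i * i = \<iota> (- a)"
        by (simp add: \<sigma>i left_diff_distrib ii emb_minus)
      then show "i \<in> {x. \<sigma> x * x \<in> range \<iota>}"
        by simp
      have "\<sigma> j * j = \<iota> (- b)"
        by (simp add: \<sigma>j jj emb_minus)
      then show "j \<in> {x. \<sigma> x * x \<in> range \<iota>}"
        by simp
      show "u + v \<in> {x. \<sigma> x * x \<in> range \<iota>}"
        if uv: "u \<in> {x. \<sigma> x * x \<in> range \<iota>}" "v \<in> {x. \<sigma> x * x \<in> range \<iota>}" for u v
      proof -
        obtain c c' where "\<sigma> u * u = \<iota> c" "\<sigma> v * v = \<iota> c'"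
          using uv by auto
        \<comment> \<open>The two mixed terms are conjugate to each other, so their sum is a trace
          and hence a scalar.\<close>
        then have "\<sigma> (u + v) * (u + v) = \<iota> c + \<iota> c' + (\<sigma> u * v + \<sigma> (\<sigma> u * v))"
          by (simp add: \<sigma>_add \<sigma>_mult invol algebra_simps)
        also have "\<dots> = \<iota> (c + c' + e (\<sigma> u * v))"
          by (simp only: tr[symmetric] emb_add)
        finally show ?thesis
          by simp
      qed
      show "u * v \<in> {x. \<sigma> x * x \<in> range \<iota>}"
        if uv: "u \<in> {x. \<sigma> x * x \<in> range \<iota>}" "v \<in> {x. \<sigma> x * x \<in> range \<iota>}" for u v
      proof -
        obtain c c' where c: "\<sigma> u * u = \<iota> c" "\<sigma> v * v = \<iota> c'"
          using uv by auto
        have "\<sigma> (u * v) * (u * v) = \<sigma> v * (\<sigma> u * u) * v"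
          by (simp only: \<sigma>_mult mult.assoc)
        also have "\<dots> = \<iota> c * (\<sigma> v * v)"
          using emb_central[of c "\<sigma> v"] by (simp only: c(1) mult.assoc[symmetric])
        also have "\<dots> = \<iota> (c * c')"
          by (simp only: c(2) emb_mult)
        finally show ?thesis
          by simp
      qed
    qed
    then show ?thesis
      by blast
  qed
  have "\<sigma> \<noteq> id"
    using \<sigma>i \<sigma>i_neq by auto
  with \<sigma>_add \<sigma>_mult invol \<sigma>_emb norm lin tr show ?thesis
    by (rule trace_pair_of_reduced_trace)
qed

text \<open>In cases (i) and (iv) the ring is commutative and \<open>\<sigma> = id\<close>, so norms
  are squares and the axioms can be checked directly. Cases (ii) and (iii) go through the reduced
  trace.\<close>

lemma trace_pair_of_associated_pair:
  assumes "central_subfield \<iota>" and dim: "has_dimension (scaleD \<iota>) UNIV d"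
    and "quadratic_type \<iota> d" and assoc: "associated_pair \<iota> d \<sigma> e"
  shows "trace_pair \<iota> \<sigma> e"
proof -
  interpret central_subfield \<iota> by fact
  have lin: "Vector_Spaces.linear (scaleD \<iota>) (*) e"
    using assoc by (simp add: associated_pair_def)
  consider "quadratic_type_1 \<iota> d" | "quadratic_type_2 \<iota> d" | "quadratic_type_3 \<iota> d"
    | "quadratic_type_4 \<iota> d"
    using assms(3) by (auto simp: quadratic_type_def)
  then show ?thesis
  proof cases
    case 1
    then have F: "range \<iota> = UNIV"
      using dim by (intro dimension_one_range) (simp add: quadratic_type_1_def)
    have \<sigma>: "\<sigma> = id" and tr: "\<iota> (e x) = (\<Sum>\<tau>\<in>galois_group \<iota>. \<tau> x)" for x
      using assoc 1 by (auto simp: associated_pair_def standard_involution_def)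
    have comm: "x * y = y * x" for x y :: 'b
      using F by (intro central_elem) auto
    have "\<tau> = id" if "\<tau> \<in> galois_group \<iota>" for \<tau>
    proof
      fix x
      obtain c where "x = \<iota> c"
        using F by blast
      then show "\<tau> x = id x"
        using that by (simp add: galois_group_def)
    qed
    moreover have "id \<in> galois_group \<iota>"
      by (simp add: galois_group_def)
    ultimately have "galois_group \<iota> = {id}"
      by blast
    then have "\<iota> (e 1) = 1"
      by (simp add: tr)
    then have "e 1 \<noteq> 0"
      by auto
    moreover have "e (x * y) = e (y * x)" for x y
      by (simp only: comm[of x])
    ultimately show ?thesis
      using lin comm F \<sigma>
      by (intro trace_pair.intro trace_pair_axioms.intro central_subfield_axioms) auto
  next
    case 2
    then show ?thesis
      using assoc dim lin
      by (intro trace_pair_quadratic)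
        (auto simp: associated_pair_def standard_involution_def quadratic_type_2_def
          separable_extension_def)
  next
    case 3
    then show ?thesis
      using assoc lin
      by (intro trace_pair_quaternion) (auto simp: associated_pair_def standard_involution_def)
  next
    case 4
    then have comm: "x * y = y * x" and sq: "x * x \<in> range \<iota>" for x y
      by (auto simp: quadratic_type_4_def commutative_ring_def power2_eq_square)
    have \<sigma>: "\<sigma> = id" and "\<exists>x. e x \<noteq> 0"
      using assoc 4 by (auto simp: associated_pair_def standard_involution_def)
    moreover have "e (x * y) = e (y * x)" for x y
      by (simp only: comm[of x])
    ultimately show ?thesis
      using lin comm sq
      by (intro trace_pair.intro trace_pair_axioms.intro central_subfield_axioms) auto
  qed
qed

section \<open>Right vector spaces over a division ring and their bases\<close>

context right_vector_space
begin

lemma scale_zero_left [simp]: "scale 0 a = 0"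
  using scale_add_left[of 0 0 a] by simp

lemma scale_zero_right [simp]: "scale x 0 = 0"
  using scale_add_right[of x 0 0] by simp

lemma scale_minus_right: "scale x (- a) = - scale x a"
  using scale_add_right[of x a "- a"] by (simp add: eq_neg_iff_add_eq_0 add.commute)

lemma scale_minus_left: "scale (- x) a = - scale x a"
  using scale_add_left[of x "- x" a] by (simp add: eq_neg_iff_add_eq_0 add.commute)

lemma scale_diff_left: "scale (x - y) a = scale x a - scale y a"
  using scale_add_left[of x "- y" a] by (simp add: scale_minus_left)

lemma scale_sum_left: "scale (\<Sum>i\<in>I. f i) a = (\<Sum>i\<in>I. scale (f i) a)"
  by (induction I rule: infinite_finite_induct) (simp_all add: scale_add_left)

lemma rsubspace_sum:
  assumes "rsubspace scale W" "\<And>i. i \<in> I \<Longrightarrow> f i \<in> W"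
  shows "(\<Sum>i\<in>I. f i) \<in> W"
  using assms(2)
  by (induction I rule: infinite_finite_induct) (use assms(1) in \<open>auto simp: rsubspace_def\<close>)

lemma rsubspace_rspan: "rsubspace scale (rspan scale X)"
  unfolding rspan_def by (rule hull_in) (auto simp: rsubspace_def)

lemma rspan_superset: "X \<subseteq> rspan scale X"
  unfolding rspan_def by (rule hull_subset)

lemma rspan_minimal: "X \<subseteq> W \<Longrightarrow> rsubspace scale W \<Longrightarrow> rspan scale X \<subseteq> W"
  unfolding rspan_def by (rule hull_minimal)

text \<open>A finite spanning set of least cardinality is independent. This justifies the choice
  made in \<open>rdim\<close>.\<close>

lemma finite_basis_exists:
  assumes "rfinite_dim scale"
  shows "\<exists>X. rindependent scale X \<and> rspan scale X = UNIV"
proof -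
  obtain X where X: "finite X" "rspan scale X = UNIV"
    and min: "\<And>Y. finite Y \<and> rspan scale Y = UNIV \<Longrightarrow> card X \<le> card Y"
    using assms ex_has_least_nat[of "\<lambda>X. finite X \<and> rspan scale X = UNIV" _ card]
    unfolding rfinite_dim_def by metis
  have "x \<notin> rspan scale (X - {x})" if "x \<in> X" for x
  proof
    assume "x \<in> rspan scale (X - {x})"
    then have "X \<subseteq> rspan scale (X - {x})"
      using rspan_superset[of "X - {x}"] by blast
    then have "rspan scale (X - {x}) = UNIV"
      using rspan_minimal[OF _ rsubspace_rspan] X(2) by blast
    then show False
      using min[of "X - {x}"] X(1) card_Diff1_less[OF X(1) that] by simp
  qed
  then show ?thesis
    using X(2) unfolding rindependent_def by blast
qed

text \<open>The cardinality of an infinite set is \<open>0\<close>, so a positive \<^term>\<open>rdim scale\<close> forces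
  the basis chosen in its definition to be finite.\<close>

lemma rdim_basis:
  assumes "rfinite_dim scale" "rdim scale > 0"
  obtains X where "finite X" "card X = rdim scale" "rindependent scale X" "rspan scale X = UNIV"
proof -
  let ?X = "SOME X. rindependent scale X \<and> rspan scale X = UNIV"
  have "rindependent scale ?X \<and> rspan scale ?X = UNIV"
    by (rule someI_ex[OF finite_basis_exists[OF assms(1)]])
  moreover have "card ?X = rdim scale"
    by (simp add: rdim_def)
  moreover have "finite ?X"
    using assms(2) calculation(2) card_gt_0_iff by metis
  ultimately show ?thesis
    using that by blast
qed

end

section \<open>Alternating operators of a sesquilinear form and deep intransitivity\<close>

locale sesquilinear_trace_form = trace_pair \<iota> \<sigma> e + U: right_vector_space sU + V: right_vector_space sV
  for \<iota> :: "'f::field \<Rightarrow> 'd::division_ring"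
    and \<sigma> :: "'d \<Rightarrow> 'd" and e :: "'d \<Rightarrow> 'f"
    and sU :: "'u::ab_group_add \<Rightarrow> 'd \<Rightarrow> 'u"
    and sV :: "'v::ab_group_add \<Rightarrow> 'd \<Rightarrow> 'v" +
  fixes B :: "'u \<Rightarrow> 'v \<Rightarrow> 'd"
  assumes sesquilinear: "sesquilinear_form sU sV \<sigma> B"
    and nondegenerate: "right_nondegenerate B"
begin

lemma B_add_left: "B (x + x') y = B x y + B x' y"
  using sesquilinear[unfolded sesquilinear_form_def, THEN conjunct1, rule_format, of x 1 x' y]
  by (simp add: U.scale_one)

lemma B_add_right: "B x (y + y') = B x y + B x y'"
  using sesquilinear[unfolded sesquilinear_form_def, THEN conjunct2, rule_format, of x y 1 y']
  by (simp add: V.scale_one)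

lemma B_zero_left [simp]: "B 0 y = 0"
  using B_add_left[of 0 0 y] by (metis add_cancel_left_left add_0)

lemma B_zero_right [simp]: "B x 0 = 0"
  using B_add_right[of x 0 0] by (metis add_cancel_left_left add_0)

lemma B_scale_left: "B (sU x a) y = \<sigma> a * B x y"
  using sesquilinear[unfolded sesquilinear_form_def, THEN conjunct1, rule_format, of x a 0 y]
  by simp

lemma B_scale_right: "B x (sV y a) = B x y * a"
  using sesquilinear[unfolded sesquilinear_form_def, THEN conjunct2, rule_format, of x y a 0]
  by simp

lemma B_diff_left: "B (x - x') y = B x y - B x' y"
  using B_add_left[of "x - x'" x' y] by (simp add: eq_diff_eq)

lemma B_diff_right: "B x (y - y') = B x y - B x y'"
  using B_add_right[of x "y - y'" y'] by (simp add: eq_diff_eq)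

lemma B_sum_left: "B (\<Sum>i\<in>I. f i) y = (\<Sum>i\<in>I. B (f i) y)"
  by (induction I rule: infinite_finite_induct) (simp_all add: B_add_left)

lemma B_sum_right: "B x (\<Sum>i\<in>I. f i) = (\<Sum>i\<in>I. B x (f i))"
  by (induction I rule: infinite_finite_induct) (simp_all add: B_add_right)

lemma B_separates: "(\<And>x. B x y = 0) \<Longrightarrow> y = 0"
  using nondegenerate by (auto simp: right_nondegenerate_def)

abbreviation A :: "('u \<Rightarrow> 'v) set" where
  "A \<equiv> alternating_operators sU sV (\<lambda>x y. e (B x y))"

lemma A_additive: "f \<in> A \<Longrightarrow> f (x + y) = f x + f y"
  and A_scale: "f \<in> A \<Longrightarrow> f (sU x a) = sV (f x) a"
  and A_alternating: "f \<in> A \<Longrightarrow> e (B x (f x)) = 0"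
  by (simp_all add: alternating_operators_def rlinear_def)

lemma A_polarize:
  assumes "f \<in> A"
  shows "e (B x (f y)) = - e (B y (f x))"
proof -
  have "e (B (x + y) (f (x + y))) = 0"
    using assms by (rule A_alternating)
  then show ?thesis
    by (simp add: A_additive[OF assms] B_add_left B_add_right e_add A_alternating[OF assms]
        eq_neg_iff_add_eq_0 add.commute)
qed

text \<open>Polarization against all multiples of \<open>y\<close> gives
  \<open>e (t * B y (f x)) = 0\<close> for every \<open>t\<close>; nondegeneracy of \<open>e\<close>
  and then of \<open>B\<close> finishes. It serves both for deep intransitivity and for killing the
  left radical of \<open>B\<close>.\<close>

lemma A_vanish:
  assumes "f \<in> A" and orth: "\<And>y. B x (f y) = 0"
  shows "f x = 0"
proof (rule B_separates)
  fix y
  show "B y (f x) = 0"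
  proof (rule e_nondegenerate)
    fix t
    \<comment> \<open>The scalar is \<open>\<sigma> t\<close> because the left argument of
      \<open>B\<close> applies \<open>\<sigma>\<close> once more.\<close>
    have "e (B (sU y (\<sigma> t)) (f x)) = 0"
      using A_polarize[OF assms(1), of "sU y (\<sigma> t)" x] by (simp add: orth)
    then show "e (t * B y (f x)) = 0"
      by (simp add: B_scale_left)
  qed
qed

lemma intransitive_subspace:
  assumes W: "rsubspace sV W" "W \<noteq> {0}"
  shows "intransitive W {f \<in> A. range f \<subseteq> W}"
  unfolding intransitive_def
proof
  fix x
  show "{f x | f. f \<in> {f \<in> A. range f \<subseteq> W}} \<noteq> W" (is "?S \<noteq> W")
  proof (cases "\<forall>y\<in>W. B x y = 0")
    case True
    then have "f x = 0" if "f \<in> A" "range f \<subseteq> W" for f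
      using that by (intro A_vanish) auto
    then have "?S \<subseteq> {0}"
      by blast
    moreover have "0 \<in> W"
      using W(1) by (simp add: rsubspace_def)
    ultimately show ?thesis
      using W(2) by blast
  next
    case False
    then obtain y where y: "y \<in> W" "B x y \<noteq> 0"
      by blast
    obtain a where a: "e a \<noteq> 0"
      using e_nonzero by blast
    \<comment> \<open>Scaled so that \<open>B x ?y = a\<close>, on which \<open>e\<close> does not
      vanish; thus \<open>?y\<close> is a vector of \<open>W\<close> that no \<open>f x\<close> can
      reach.\<close>
    let ?y = "sV y (inverse (B x y) * a)"
    have "?y \<in> W"
      using W(1) y(1) by (simp add: rsubspace_def)
    moreover have "e (B x ?y) \<noteq> 0"
      using y(2) a by (simp add: B_scale_right mult.assoc[symmetric])
    then have "f x \<noteq> ?y" if "f \<in> A" for f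
      using A_alternating[OF that, of x] by metis
    then have "?y \<notin> ?S"
      by fastforce
    ultimately show ?thesis
      by metis
  qed
qed

text \<open>Intransitivity of \<open>A\<close> itself is the case \<open>W = UNIV\<close>; the
  vector \<open>y\<close> only witnesses that this space is nonzero.\<close>

lemma deeply_intransitive_A:
  assumes "(y :: 'v) \<noteq> 0"
  shows "deeply_intransitive sV A"
proof -
  have "rsubspace sV UNIV"
    by (simp add: rsubspace_def)
  moreover have "(UNIV :: 'v set) \<noteq> {0}"
    using assms by blast
  ultimately have "intransitive UNIV A"
    using intransitive_subspace[of UNIV] by simp
  then show ?thesis
    unfolding deeply_intransitive_def using intransitive_subspace by blast
qed

section \<open>Dual bases and matrices of alternating operators\<close>

text \<open>A Gram-Schmidt induction: each new \<open>y\<close> gets a dual vector vanishing on the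
  earlier ones, and the earlier dual vectors are then corrected to vanish at
  \<open>y\<close>.\<close>

lemma dual_family:
  assumes "finite Y" "Y \<subseteq> X" "rindependent sV X"
  shows "\<exists>u. \<forall>v\<in>Y. \<forall>v'\<in>Y. B (u v) v' = (if v = v' then 1 else 0)"
  using assms(1,2)
proof (induction Y rule: finite_induct)
  case (insert y Y)
  obtain u where u: "\<And>v v'. v \<in> Y \<Longrightarrow> v' \<in> Y \<Longrightarrow> B (u v) v' = (if v = v' then 1 else 0)"
    using insert by blast
  \<comment> \<open>The combination of \<open>Y\<close> on which every \<open>B (u v)\<close> agrees
    with its value at \<open>y\<close>.\<close>
  define p where "p = (\<Sum>v\<in>Y. sV v (B (u v) y))"
  have "p \<in> rspan sV (X - {y})"
    unfolding p_def
  proof (rule V.rsubspace_sum[OF V.rsubspace_rspan])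
    fix v assume "v \<in> Y"
    then have "v \<in> rspan sV (X - {y})"
      using insert V.rspan_superset[of "X - {y}"] by blast
    then show "sV v (B (u v) y) \<in> rspan sV (X - {y})"
      using V.rsubspace_rspan by (simp add: rsubspace_def)
  qed
  moreover have "y \<notin> rspan sV (X - {y})"
    using insert.prems assms(3) by (simp add: rindependent_def)
  ultimately have "y - p \<noteq> 0"
    by auto
  then obtain x where x: "B x (y - p) \<noteq> 0"
    using B_separates by blast
  \<comment> \<open>This correction makes \<open>B x'\<close> vanish on \<open>Y\<close>. It is
    adjoint to passing from \<open>y\<close> to \<open>y - p\<close>, so
    \<open>B x' y = B x (y - p)\<close> stays nonzero.\<close>
  define x' where "x' = x - (\<Sum>v\<in>Y. sU (u v) (\<sigma> (B x v)))"
  have x'_Y: "B x' v = 0" if "v \<in> Y" for v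
  proof -
    have "(\<Sum>v'\<in>Y. B x v' * B (u v') v) = (\<Sum>v'\<in>Y. if v' = v then B x v' else 0)"
      using that by (intro sum.cong) (auto simp: u)
    then show ?thesis
      using that insert.hyps(1) by (simp add: x'_def B_diff_left B_sum_left B_scale_left)
  qed
  have "B x' y = B x (y - p)"
    by (simp add: x'_def p_def B_diff_left B_diff_right B_sum_left B_sum_right B_scale_left
        B_scale_right)
  with x have B_x'_y: "B x' y \<noteq> 0"
    by simp
  define w where "w = sU x' (\<sigma> (inverse (B x' y)))"
  have w: "B w y = 1" "\<And>v. v \<in> Y \<Longrightarrow> B w v = 0"
    using B_x'_y x'_Y by (simp_all add: w_def B_scale_left)
  define u' where "u' v = (if v = y then w else u v - sU w (\<sigma> (B (u v) y)))" for v
  have "B (u' v) v' = (if v = v' then 1 else 0)" if "v \<in> insert y Y" "v' \<in> insert y Y" for v v'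
    using that insert.hyps(2) w u by (auto simp: u'_def B_diff_left B_scale_left)
  then show ?case
    by blast
qed simp

text \<open>The expansion holds on the basis \<open>X\<close> by duality, and the vectors satisfying
  it form a subspace, hence all of V.\<close>

lemma dual_bases:
  assumes "rfinite_dim sV" "rdim sV = n" "n > 0"
  obtains u v where "\<And>i j. i < n \<Longrightarrow> j < n \<Longrightarrow> B (u i) (v j) = (if i = j then 1 else 0)"
    "\<And>y. (\<Sum>i<n. sV (v i) (B (u i) y)) = y"
proof -
  obtain X where X: "finite X" "card X = n" "rindependent sV X" "rspan sV X = UNIV"
    using V.rdim_basis assms by metis
  obtain u where u: "\<And>v v'. v \<in> X \<Longrightarrow> v' \<in> X \<Longrightarrow> B (u v) v' = (if v = v' then 1 else 0)"
    using dual_family[OF X(1) order_refl X(3)] by blast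
  obtain v where v: "bij_betw v {..<n} X"
    using ex_bij_betw_nat_finite[OF X(1)] X(2) by (auto simp: atLeast0LessThan)
  have "(\<Sum>x\<in>X. sV x (B (u x) y)) = y" for y
  proof -
    have "X \<subseteq> {y. (\<Sum>x\<in>X. sV x (B (u x) y)) = y}"
    proof
      fix y assume "y \<in> X"
      then have "(\<Sum>x\<in>X. sV x (B (u x) y)) = (\<Sum>x\<in>X. if x = y then x else 0)"
        by (intro sum.cong) (auto simp: u V.scale_one)
      then show "y \<in> {y. (\<Sum>x\<in>X. sV x (B (u x) y)) = y}"
        using X(1) \<open>y \<in> X\<close> by simp
    qed
    moreover have "rsubspace sV {y. (\<Sum>x\<in>X. sV x (B (u x) y)) = y}"
      by (auto simp: rsubspace_def B_add_right V.scale_add_right sum.distrib B_scale_right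
          V.scale_scale[symmetric] V.scale_sum_left[symmetric])
    ultimately show ?thesis
      using V.rspan_minimal X(4) by blast
  qed
  then have "(\<Sum>i<n. sV (v i) (B (u (v i)) y)) = y" for y
    using sum.reindex_bij_betw[OF v, of "\<lambda>x. sV x (B (u x) y)"] by simp
  moreover have "B (u (v i)) (v j) = (if i = j then 1 else 0)" if "i < n" "j < n" for i j
    using that u bij_betwE[OF v] bij_betw_imp_inj_on[OF v] by (auto simp: inj_on_def)
  ultimately show ?thesis
    using that[of "u \<circ> v" v] by simp
qed

lemma subspace_A: "module.subspace (scaleHom \<iota> sV) A"
proof -
  interpret vector_space "scaleHom \<iota> sV"
    by (rule vector_space_scaleHom) (rule central_subfield_axioms V.right_vector_space_axioms)+
  show ?thesis
    unfolding subspace_def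
  proof (intro conjI ballI allI)
    show "0 \<in> A"
      by (simp add: alternating_operators_def rlinear_def)
    show "f + g \<in> A" if "f \<in> A" "g \<in> A" for f g
      using that by (simp add: alternating_operators_def rlinear_def V.scale_add_left B_add_right
          e_add algebra_simps)
    show "scaleHom \<iota> sV c f \<in> A" if "f \<in> A" for c f
      using that emb_central[of c]
      by (simp add: alternating_operators_def rlinear_def scaleHom_def V.scale_add_left
          V.scale_scale B_scale_right e_scale flip: emb_central)
  qed
qed

lemma operator_additive:
  assumes "f \<in> A"
  shows "f (\<Sum>i\<in>I. g i) = (\<Sum>i\<in>I. f (g i))" and "f (x - y) = f x - f y"
proof -
  have zero: "f 0 = 0"
    using A_additive[OF assms, of 0 0] by (metis add_cancel_left_left add_0)
  show "f (\<Sum>i\<in>I. g i) = (\<Sum>i\<in>I. f (g i))"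
    by (induction I rule: infinite_finite_induct) (simp_all add: zero A_additive[OF assms])
  show "f (x - y) = f x - f y"
    using A_additive[OF assms, of "x - y" y] by (simp add: eq_diff_eq)
qed

text \<open>The \<open>u j\<close> need not span U. However, \<open>x\<close> minus its projection
  \<open>p\<close> onto them is annihilated by \<open>B\<close> in the left argument, so
  \<open>f\<close> kills the difference by \<open>A_vanish\<close>.\<close>

lemma matrix_expansion:
  fixes n :: nat
  assumes f: "f \<in> A"
    and dual: "\<And>i j. i < n \<Longrightarrow> j < n \<Longrightarrow> B (u i) (v j) = (if i = j then 1 else 0)"
    and basis: "\<And>y. (\<Sum>i<n. sV (v i) (B (u i) y)) = y"
  shows "f x = (\<Sum>j<n. \<Sum>i<n. sV (v i) (B (u i) (f (u j)) * \<sigma> (B x (v j))))"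
proof -
  define p where "p = (\<Sum>j<n. sU (u j) (\<sigma> (B x (v j))))"
  have *: "B (x - p) (v i) = 0" if "i < n" for i
  proof -
    have "(\<Sum>j<n. B x (v j) * B (u j) (v i)) = (\<Sum>j<n. if j = i then B x (v j) else 0)"
      using that by (intro sum.cong) (auto simp: dual)
    then show ?thesis
      using that by (simp add: p_def B_diff_left B_sum_left B_scale_left)
  qed
  have "B (x - p) y = 0" for y
  proof -
    have "B (x - p) y = (\<Sum>i<n. B (x - p) (v i) * B (u i) y)"
      by (subst basis[of y, symmetric]) (simp only: B_sum_right B_scale_right)
    then show ?thesis
      by (simp add: *)
  qed
  then have "f (x - p) = 0"
    by (intro A_vanish[OF f])
  then have "f x = (\<Sum>j<n. sV (f (u j)) (\<sigma> (B x (v j))))"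
    by (simp add: operator_additive[OF f] p_def A_scale[OF f])
  also have "\<dots> = (\<Sum>j<n. \<Sum>i<n. sV (v i) (B (u i) (f (u j)) * \<sigma> (B x (v j))))"
  proof (rule sum.cong[OF refl])
    fix j
    have "sV (f (u j)) c = (\<Sum>i<n. sV (v i) (B (u i) (f (u j)) * c))" for c
      by (subst basis[of "f (u j)", symmetric]) (simp only: V.scale_sum_left V.scale_scale)
    then show "sV (f (u j)) (\<sigma> (B x (v j))) =
        (\<Sum>i<n. sV (v i) (B (u i) (f (u j)) * \<sigma> (B x (v j))))" .
  qed
  finally show ?thesis .
qed

text \<open>Polarization only controls values of \<open>e\<close>; replacing \<open>x\<close> by its
  multiples by \<open>t\<close> and using nondegeneracy of \<open>e\<close> gives the identity in
  the division ring.\<close>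

lemma matrix_skew:
  assumes f: "f \<in> A"
  shows "B y (f x) = - \<sigma> (B x (f y))"
proof -
  have "\<sigma> (B x (f y)) + B y (f x) = 0"
  proof (rule e_nondegenerate)
    fix t
    have "e (t * \<sigma> (B x (f y))) = e (B x (f y) * \<sigma> t)"
      using e_\<sigma>[of "B x (f y) * \<sigma> t"] by (simp add: \<sigma>_mult)
    also have "\<dots> = e (B (sU x t) (f y))"
      by (simp add: B_scale_left e_commute)
    also have "\<dots> = - e (B y (f x) * t)"
      using A_polarize[OF f, of "sU x t" y] by (simp add: A_scale[OF f] B_scale_right)
    finally show "e (t * (\<sigma> (B x (f y)) + B y (f x))) = 0"
      by (simp add: distrib_left e_add e_commute[of t "B y (f x)"])
  qed
  then show ?thesis
    by (metis add_eq_0_iff)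
qed

end

section \<open>The dimension of the space of alternating operators\<close>

text \<open>The induction splits the last row and column off the square. It pairs the matrix entries
  at \<open>(i, j)\<close> and \<open>(j, i)\<close>.\<close>

lemma sum_square_triangle:
  fixes F :: "nat \<Rightarrow> nat \<Rightarrow> 'a::comm_monoid_add"
  shows "(\<Sum>j<n. \<Sum>i<n. F i j) = (\<Sum>j<n. \<Sum>i\<le>j. if i = j then F i i else F i j + F j i)"
proof (induction n)
  case (Suc n)
  have "(\<Sum>i\<le>n. if i = n then F i i else F i n + F n i) = (\<Sum>i<n. F i n + F n i) + F n n"
    by (simp add: lessThan_Suc_atMost[symmetric])
  with Suc show ?case
    by (simp add: sum.distrib add_ac)
qed simp

text \<open>Counts the free scalar parameters of the matrix: \<open>d - 1\<close> for a diagonal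
  entry in the kernel of \<open>e\<close>, and \<open>d\<close> for an entry above the
  diagonal.\<close>

lemma card_triangle:
  fixes d n :: nat
  shows "(\<Sum>j<n. \<Sum>i\<le>j. if i = j then d - 1 else d) = n * (d - 1) + d * (n choose 2)"
proof (induction n)
  case (Suc n)
  have "(\<Sum>i\<le>n. if i = n then d - 1 else d) = n * d + (d - 1)"
    by (simp add: lessThan_Suc_atMost[symmetric])
  with Suc show ?case
    by (simp add: numeral_2_eq_2 distrib_left mult.commute[of d n])
qed simp

lemma sum_fun_apply: "(\<Sum>i\<in>I. f i) x = (\<Sum>i\<in>I. f i x)"
  by (induction I rule: infinite_finite_induct) simp_all

text \<open>The basis consists of operators whose matrix has one free entry, taken from the adapted
  basis of the division ring, and its forced mirror entry. The dual functionals read the coordinates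
  of the upper triangle.\<close>

lemma (in sesquilinear_trace_form) has_dimension_A:
  assumes "has_dimension (scaleD \<iota>) UNIV d" "rfinite_dim sV" "rdim sV = n" "n > 0"
  shows "has_dimension (scaleHom \<iota> sV) A (n * (d - 1) + d * (n choose 2))"
proof -
  interpret vector_space "scaleHom \<iota> sV"
    by (rule vector_space_scaleHom) (rule central_subfield_axioms V.right_vector_space_axioms)+
  obtain u v where dual: "\<And>i j. i < n \<Longrightarrow> j < n \<Longrightarrow> B (u i) (v j) = (if i = j then 1 else 0)"
    and basis: "\<And>y. (\<Sum>i<n. sV (v i) (B (u i) y)) = y"
    using dual_bases[OF assms(2-4)] by metis
  obtain K a0 \<gamma> where K: "finite K" "card K = d - 1" "d > 0" "a0 \<notin> K"
    and eK: "\<And>k. k \<in> K \<Longrightarrow> e k = 0"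
    and \<gamma>_add: "\<And>k a b. \<gamma> k (a + b) = (\<gamma> k a + \<gamma> k b :: 'f)"
    and \<gamma>_scale: "\<And>k c a. \<gamma> k (\<iota> c * a) = c * \<gamma> k a"
    and \<gamma>_dual: "\<And>k l. k \<in> insert a0 K \<Longrightarrow> l \<in> insert a0 K \<Longrightarrow> \<gamma> k l = (if k = l then 1 else 0)"
    and \<gamma>_expand: "\<And>a. (\<Sum>k\<in>insert a0 K. \<iota> (\<gamma> k a) * k) = a"
    and \<gamma>_ker: "\<And>a. e a = 0 \<Longrightarrow> \<gamma> a0 a = 0"
    using adapted_coordinates[OF assms(1)] by blast
  have \<gamma>_zero [simp]: "\<gamma> k 0 = 0" for k
    using \<gamma>_scale[of k 0 0] by simp
  \<comment> \<open>A matrix unit: \<open>h i j a\<close> sends \<open>u j\<close> to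
    \<open>sV (v i) a\<close> and every other \<open>u\<close> of the family to
    \<open>0\<close>.\<close>
  define h where "h i j a x = sV (v i) (a * \<sigma> (B x (v j)))" for i j a x
  \<comment> \<open>Off the diagonal, the entry \<open>- \<sigma> a\<close> at \<open>(j, i)\<close>
    is the one dictated by \<open>matrix_skew\<close>.\<close>
  define H where "H i j a x = (if i = j then h i i a x else h i j a x - h j i (\<sigma> a) x)"
    for i j a x
  define M where "M i j = (if i = j then K else insert a0 K)" for i j :: nat
  define I where "I = (SIGMA j:{..<n}. SIGMA i:{..j}. M i j)"
  define g where "g = (\<lambda>(j, i, k). H i j k)"
  define \<phi> where "\<phi> = (\<lambda>(j, i, k) f. \<gamma> k (B (u i) (f (u j))))"
  have M: "finite (M i j)" "card (M i j) = (if i = j then d - 1 else d)" "M i j \<subseteq> insert a0 K"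
    for i j
    using K by (auto simp: M_def)
  have H_add: "H i j (a + a') x = H i j a x + H i j a' x" for i j a a' x
    by (simp add: H_def h_def \<sigma>_add distrib_right V.scale_add_right)
  have H_zero: "H i j 0 x = 0" for i j x
    by (simp add: H_def h_def)
  have H_sum: "H i j (\<Sum>k\<in>X. p k) x = (\<Sum>k\<in>X. H i j (p k) x)" for i j x X and p :: "'d \<Rightarrow> 'd"
    by (induction X rule: infinite_finite_induct) (simp_all add: H_add H_zero)
  have h_scale: "sV (h i j a x) (\<iota> c) = h i j (\<iota> c * a) x" for i j a x c
    by (simp add: h_def V.scale_scale mult.assoc flip: emb_central)
  have H_scale: "sV (H i j a x) (\<iota> c) = H i j (\<iota> c * a) x" for i j a x c
    using emb_central[of c "\<sigma> a"]
    by (simp add: H_def h_scale V.scale_diff_left \<sigma>_mult \<sigma>_emb)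
  have H_expand: "(\<Sum>k\<in>M i j. sV (H i j k x) (\<iota> (\<gamma> k a))) = H i j a x"
    if "i = j \<Longrightarrow> e a = 0" for i j a x
  proof -
    have "(\<Sum>k\<in>M i j. sV (H i j k x) (\<iota> (\<gamma> k a))) = H i j (\<Sum>k\<in>M i j. \<iota> (\<gamma> k a) * k) x"
      by (simp add: H_scale H_sum)
    \<comment> \<open>On the diagonal \<open>a0\<close> is missing from \<open>M i j\<close>, but
      its coefficient is zero because \<open>e a = 0\<close>.\<close>
    also have "(\<Sum>k\<in>M i j. \<iota> (\<gamma> k a) * k) = (\<Sum>k\<in>insert a0 K. \<iota> (\<gamma> k a) * k)"
      using that K \<gamma>_ker[of a] by (auto simp: M_def)
    finally show ?thesis
      by (simp only: \<gamma>_expand)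
  qed
  have H_alternating: "H i j a \<in> A" if "i = j \<Longrightarrow> e a = 0" for i j a
  proof -
    have "h i j a (x + y) = h i j a x + h i j a y" for i j a x y
      by (simp add: h_def B_add_left \<sigma>_add distrib_left V.scale_add_right)
    moreover have "h i j a (sU x c) = sV (h i j a x) c" for i j a x c
      by (simp add: h_def B_scale_left \<sigma>_mult V.scale_scale mult.assoc)
    ultimately have "rlinear sU sV (H i j a)"
      by (simp add: rlinear_def H_def V.scale_diff_left)
    moreover have "e (B x (H i j a x)) = 0" for x
    proof (cases "i = j")
      case True
      then show ?thesis
        using e_conjugate[OF that, of "B x (v i)"]
        by (simp add: H_def h_def B_scale_right mult.assoc)
    next
      case False
      \<comment> \<open>The two mirror terms are conjugate under \<open>\<sigma>\<close>, so they
        cancel after \<open>e\<close>.\<close>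
      have "e (B x (v i) * (a * \<sigma> (B x (v j)))) = e (B x (v j) * (\<sigma> a * \<sigma> (B x (v i))))"
        using e_\<sigma>[of "B x (v i) * (a * \<sigma> (B x (v j)))"] by (simp add: \<sigma>_mult mult.assoc)
      then show ?thesis
        using False by (simp add: H_def h_def B_diff_right B_scale_right e_diff)
    qed
    ultimately show ?thesis
      by (simp add: alternating_operators_def)
  qed
  have B_h: "B (u i) (h i' j' a (u j)) = (if i = i' \<and> j = j' then a else 0)"
    if "i < n" "j < n" "i' < n" "j' < n" for i j i' j' a
    using that by (simp add: h_def B_scale_right dual)
  \<comment> \<open>With \<open>i \<le> j\<close> and \<open>i' \<le> j'\<close>, the mirror entry
    lies strictly below the diagonal and is never read.\<close>
  have B_H: "B (u i) (H i' j' a (u j)) = (if i = i' \<and> j = j' then a else 0)"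
    if "i \<le> j" "j < n" "i' \<le> j'" "j' < n" for i j i' j' a
    using that by (auto simp: H_def B_diff_right B_h)
  have "has_dimension (scaleHom \<iota> sV) A (card I)"
  proof (rule has_dimension_dual_family[where g = g and \<phi> = \<phi>])
    show "finite I"
      by (simp add: I_def M(1))
    show "subspace A"
      by (rule subspace_A)
    show "g p \<in> A" if "p \<in> I" for p
      using that by (auto simp: I_def g_def M_def eK split: if_splits intro!: H_alternating)
    show "\<phi> p (f + f') = \<phi> p f + \<phi> p f'" for p f f'
      by (cases p) (simp add: \<phi>_def B_add_right \<gamma>_add)
    show "\<phi> p (scaleHom \<iota> sV c f) = c * \<phi> p f" for p c f
      by (cases p) (simp add: \<phi>_def scaleHom_def B_scale_right \<gamma>_scale flip: emb_central)
    show "\<phi> p (g q) = (if p = q then 1 else 0)" if "p \<in> I" "q \<in> I" for p q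
    proof -
      obtain j i k j' i' k' where pq: "p = (j, i, k)" "q = (j', i', k')"
        by (metis prod_cases3)
      have "\<gamma> k k' = (if k = k' then 1 else 0)"
        by (rule \<gamma>_dual) (use that M(3) pq in \<open>auto simp: I_def\<close>)
      moreover have "i \<le> j" "j < n" "i' \<le> j'" "j' < n"
        using that pq by (auto simp: I_def)
      ultimately show ?thesis
        by (auto simp: pq \<phi>_def g_def B_H)
    qed
    show "f = (\<Sum>p\<in>I. scaleHom \<iota> sV (\<phi> p f) (g p))" if f: "f \<in> A" for f
    proof
      fix x
      define a where "a i j = B (u i) (f (u j))" for i j
      have "f x = (\<Sum>j<n. \<Sum>i<n. h i j (a i j) x)"
        unfolding h_def a_def by (rule matrix_expansion[OF f dual basis])
      also have "\<dots> = (\<Sum>j<n. \<Sum>i\<le>j. if i = j then h i i (a i i) x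
          else h i j (a i j) x + h j i (a j i) x)"
        by (rule sum_square_triangle)
      also have "\<dots> = (\<Sum>j<n. \<Sum>i\<le>j. H i j (a i j) x)"
      proof (intro sum.cong refl)
        fix i j
        have "a j i = - \<sigma> (a i j)"
          unfolding a_def by (rule matrix_skew[OF f])
        then show "(if i = j then h i i (a i i) x else h i j (a i j) x + h j i (a j i) x) =
            H i j (a i j) x"
          by (simp add: H_def h_def V.scale_minus_right)
      qed
      also have "\<dots> = (\<Sum>j<n. \<Sum>i\<le>j. \<Sum>k\<in>M i j. sV (H i j k x) (\<iota> (\<gamma> k (a i j))))"
        by (simp add: H_expand a_def A_alternating[OF f])
      also have "\<dots> = (\<Sum>(j, i, k)\<in>I. sV (H i j k x) (\<iota> (\<gamma> k (a i j))))"
        by (simp add: I_def sum.Sigma M(1))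
      also have "\<dots> = (\<Sum>p\<in>I. scaleHom \<iota> sV (\<phi> p f) (g p)) x"
        by (simp add: sum_fun_apply scaleHom_def \<phi>_def g_def a_def case_prod_unfold)
      finally show "f x = (\<Sum>p\<in>I. scaleHom \<iota> sV (\<phi> p f) (g p)) x" .
    qed
  qed
  also have "card I = n * (d - 1) + d * (n choose 2)"
    by (simp add: I_def M card_triangle)
  finally show ?thesis .
qed

theorem proposition1p24:
  fixes \<iota> :: "'f::field \<Rightarrow> 'd::division_ring"
    and d n :: nat
    and \<sigma> :: "'d \<Rightarrow> 'd" and e :: "'d \<Rightarrow> 'f"
    and sU :: "'u::ab_group_add \<Rightarrow> 'd \<Rightarrow> 'u"
    and sV :: "'v::ab_group_add \<Rightarrow> 'd \<Rightarrow> 'v"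
    and B :: "'u \<Rightarrow> 'v \<Rightarrow> 'd" and b :: "'u \<Rightarrow> 'v \<Rightarrow> 'f"
  assumes "central_subfield \<iota>"
    and "has_dimension (scaleD \<iota>) UNIV d"
    and "quadratic_type \<iota> d"
    and "associated_pair \<iota> d \<sigma> e"
    and "right_vector_space sU" and "rfinite_dim sU"
    and "right_vector_space sV" and "rfinite_dim sV"
    and "n = rdim sV" and "n > 0"
    and "sesquilinear_form sU sV \<sigma> B"
    and "right_nondegenerate B"
    and "b = (\<lambda>x y. e (B x y))"
  shows "has_dimension (scaleHom \<iota> sV) (alternating_operators sU sV b) (n * (d - 1) + d * (n choose 2))
    \<and> deeply_intransitive sV (alternating_operators sU sV b)"
proof -
  interpret trace_pair \<iota> \<sigma> e
    by (rule trace_pair_of_associated_pair) fact+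
  interpret sesquilinear_trace_form \<iota> \<sigma> e sU sV B
    by (intro sesquilinear_trace_form.intro sesquilinear_trace_form_axioms.intro
        trace_pair_axioms) fact+
  have "has_dimension (scaleHom \<iota> sV) A (n * (d - 1) + d * (n choose 2))"
    using assms(2,8-10) by (intro has_dimension_A) simp_all
  moreover have "deeply_intransitive sV A"
  proof -
    \<comment> \<open>The dual bases supply a nonzero vector of V, namely \<open>v 0\<close>, since
      \<open>n > 0\<close>.\<close>
    obtain u v where "\<And>i j. i < n \<Longrightarrow> j < n \<Longrightarrow> B (u i) (v j) = (if i = j then 1 else 0)"
      using dual_bases[OF assms(8) assms(9)[symmetric] assms(10)] by metis
    then have "B (u 0) (v 0) = 1"
      using assms(10) by simp
    then have "v 0 \<noteq> 0"
      by auto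
    then show ?thesis
      by (rule deeply_intransitive_A)
  qed
  ultimately show ?thesis
    by (simp add: assms(13))
qed

end
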